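(* There does not exist a distance-regular graph with intersection array $\{80, 54, 12; 1, 6, 60\}$.
   Context: All graphs are finite, undirected and simple. A connected graph $\Gamma$ of diameter $D$ is distance-regular with intersection array $\{b_0,b_1,\ldots,b_{D-1};c_1,c_2,\ldots,c_D\}$ if for every $i\in\{0,\ldots,D\}$ and every pair of vertices $x,y$ at distance $i$, the number of neighbors of $y$ at distance $i-1$ from $x$ equals $c_i$ and the number of neighbors of $y$ at distance $i+1$ from $x$ equals $b_i$ (with $c_0=b_D=0$); both numbers depend only on $i$. *)

theory Defs
  imports "Graph_Theory.Graph_Theory"
begin

text \<open>
  A finite simple undirected graph is a \<open>pair_graph\<close>: a finite vertex set with a symmetric,
  irreflexive adjacency relation. The library coerces it to a \<open>pre_digraph\<close> by \<open>with_proj\<close>.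
  Its shortest-path cost with all weights equal to 1 is the usual graph distance,
  with value \<open>\<infinity>\<close> between different components.
\<close>

definition gdist :: "'a pair_pre_digraph \<Rightarrow> 'a \<Rightarrow> 'a \<Rightarrow> ereal" where
  "gdist G x y = wf_digraph.\<mu> (with_proj G) (\<lambda>_. 1) x y"

lemma (in pair_wf_digraph) gdist_eq_walk_length:
  "gdist G x y = (INF p\<in>{p. awalk x p y}. ereal (real (length p)))"
proof -
  have "awalk_cost (\<lambda>_. 1) p = real (length p)" for p
    by (simp add: awalk_cost_def sum_list_triv)
  then show ?thesis
    by (simp add: gdist_def \<mu>_def)
qed

definition graph_diameter :: "'a pair_pre_digraph \<Rightarrow> ereal" where
  "graph_diameter G = (SUP (x, y)\<in>pverts G \<times> pverts G. gdist G x y)"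

text \<open>
  The array \<open>{b\<^sub>0, \<dots>, b\<^bsub>D-1\<^esub>; c\<^sub>1, \<dots>, c\<^sub>D}\<close> is given by the lists
  \<open>bs = [b\<^sub>0, \<dots>, b\<^bsub>D-1\<^esub>]\<close> and \<open>cs = [c\<^sub>1, \<dots>, c\<^sub>D]\<close>. The conventions \<open>b\<^sub>D = 0\<close> and
  \<open>c\<^sub>0 = 0\<close> are expressed by appending and prepending 0, so that \<open>b\<^sub>i = (bs @ [0]) ! i\<close>
  and \<open>c\<^sub>i = (0 # cs) ! i\<close> for \<open>i \<le> D\<close>. The distance \<open>i - 1\<close> is taken in the extended
  reals: for \<open>i = 0\<close> it is \<open>-1\<close>, which no vertex has.
  The library's \<open>connected\<close> includes that the vertex set is nonempty.
\<close>

definition distance_regular :: "'a pair_pre_digraph \<Rightarrow> nat list \<Rightarrow> nat list \<Rightarrow> bool" where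
  "distance_regular G bs cs \<longleftrightarrow>
     pair_graph G \<and>
     Digraph_Component.connected (with_proj G) \<and>
     length cs = length bs \<and>
     graph_diameter G = ereal (real (length bs)) \<and>
     (\<forall>i \<le> length bs. \<forall>x \<in> pverts G. \<forall>y \<in> pverts G. gdist G x y = ereal (real i) \<longrightarrow>
        card {z. y \<rightarrow>\<^bsub>with_proj G\<^esub> z \<and> gdist G x z = ereal (real i - 1)} = (0 # cs) ! i \<and>
        card {z. y \<rightarrow>\<^bsub>with_proj G\<^esub> z \<and> gdist G x z = ereal (real i + 1)} = (bs @ [0]) ! i)"

end

theory Submission
  imports Defs
begin

text \<open>
  Fix a vertex \<open>x\<close>. Its local graph has 80 vertices, is 25-regular, and two nonadjacent vertices of
  it have at most 5 common neighbours in it. Counting closed neighbourhoods, a coclique of size 5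
  in such a graph is tight: each pair of its vertices has exactly 5 common neighbours, and no vertex
  is adjacent to three of them. Replacing one or two vertices of a 5-coclique gives further
  5-cocliques, all of them tight, and this rigidity ends in a parity contradiction (25 would be
  even). So the local graph has no 5-coclique. The private neighbourhoods of a 4-coclique
  are then cliques with at least 11 vertices, and every vertex is completely joined to one of them,
  so four cliques cover the local graph.

  The eigenvalue \<open>-4\<close> gives the clique bound 21, with exactly 3 neighbours in a 21-clique \<open>C\<close> for every
  vertex adjacent to \<open>C\<close> from outside. So the four cliques have size 20 and partition the local
  graph: the graph is geometric, with lines of size 21. For \<open>v\<close> adjacent to a line \<open>C\<close> from
  outside, the pairs of a neighbour \<open>w\<close> of \<open>v\<close> and a neighbour of \<open>w\<close> in \<open>C\<close> number
  \<open>3 * 25 + 18 * 6 = 183\<close>, while the three lines joining \<open>v\<close> to \<open>C\<close> alone give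
  \<open>3 * 20 + 57 * 3 = 231\<close>.
\<close>

section \<open>Tight 5-cocliques in the local graph\<close>

lemma sum_card_swap:
  assumes "finite A" "finite B"
  shows "(\<Sum>x\<in>A. card {y\<in>B. R x y}) = (\<Sum>y\<in>B. card {x\<in>A. R x y})"
proof -
  have "(\<Sum>x\<in>A. card {y\<in>B. R x y}) = (\<Sum>x\<in>A. \<Sum>y\<in>B. if R x y then 1 else 0)"
    using assms by (simp only: card_eq_sum sum.inter_filter)
  also have "\<dots> = (\<Sum>y\<in>B. \<Sum>x\<in>A. if R x y then 1 else 0)"
    by (rule sum.swap)
  also have "\<dots> = (\<Sum>y\<in>B. card {x\<in>A. R x y})"
    using assms by (simp only: card_eq_sum sum.inter_filter)
  finally show ?thesis .
qed

lemma card_pairs: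
  fixes M :: "'b set"
  assumes "finite M"
  shows "int (card {p \<in> M \<times> M. fst p \<noteq> snd p}) = int (card M) * (int (card M) - 1)"
proof -
  have "{p \<in> M \<times> M. fst p \<noteq> snd p} = M \<times> M - (\<lambda>x. (x, x)) ` M" by auto
  moreover have "card ((\<lambda>x. (x, x)) ` M) = card M"
    by (intro card_image) (auto simp: inj_on_def)
  moreover have "card (M \<times> M - (\<lambda>x. (x, x)) ` M) = card (M \<times> M) - card ((\<lambda>x. (x, x)) ` M)"
    using assms by (intro card_Diff_subset) auto
  moreover have "card M \<le> card M * card M"
    by (cases "card M") auto
  ultimately show ?thesis
    using assms by (simp add: card_cartesian_product of_nat_diff algebra_simps)
qed

text \<open>The constants come from the array: 80 is the valency, 25 = 80 - 54 - 1, and 5 = 6 - 1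
  because the base vertex is itself a common neighbour. \<open>E\<close> may be the adjacency of a
  larger graph, so counts are restricted to \<open>V\<close>.\<close>

locale local_graph =
  fixes V :: "'a set" and E :: "'a \<Rightarrow> 'a \<Rightarrow> bool"
  assumes finite_V: "finite V"
    and E_sym: "E x y \<Longrightarrow> E y x"
    and E_irrefl: "\<not> E x x"
    and card_V: "card V = 80"
    and regular: "x \<in> V \<Longrightarrow> card {y \<in> V. E x y} = 25"
    and common_le: "x \<in> V \<Longrightarrow> y \<in> V \<Longrightarrow> x \<noteq> y \<Longrightarrow> \<not> E x y \<Longrightarrow> card {z \<in> V. E z x \<and> E z y} \<le> 5"
begin

text \<open>With closed adjacency a member of a coclique sees itself, so counts over all of
  \<open>V\<close> need no exception.\<close>

definition cl :: "'a \<Rightarrow> 'a \<Rightarrow> bool" where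
  "cl x y \<longleftrightarrow> x = y \<or> E x y"

definition coclique :: "'a set \<Rightarrow> bool" where
  "coclique S \<longleftrightarrow> S \<subseteq> V \<and> (\<forall>a\<in>S. \<forall>b\<in>S. \<not> E a b)"

section \<open>Closed neighbourhoods and cocliques\<close>

lemma cl_refl [simp]: "cl x x"
  by (simp add: cl_def)

lemma cl_commute: "cl x y \<longleftrightarrow> cl y x"
  using E_sym by (auto simp: cl_def)

lemma coclique_finite: "coclique S \<Longrightarrow> finite S"
  using finite_V finite_subset by (auto simp: coclique_def)

lemma coclique_cl: "coclique S \<Longrightarrow> a \<in> S \<Longrightarrow> b \<in> S \<Longrightarrow> cl a b \<longleftrightarrow> a = b"
  by (auto simp: coclique_def cl_def)

lemma coclique_insert:
  "coclique S \<Longrightarrow> z \<in> V \<Longrightarrow> (\<And>s. s \<in> S \<Longrightarrow> \<not> cl z s) \<Longrightarrow> coclique (insert z S)"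
  using E_irrefl E_sym by (auto simp: coclique_def cl_def)

lemma coclique_subset: "coclique S \<Longrightarrow> T \<subseteq> S \<Longrightarrow> coclique T"
  by (auto simp: coclique_def)

lemma card_cl:
  assumes "x \<in> V"
  shows "card {y \<in> V. cl y x} = 26"
proof -
  have "{y \<in> V. cl y x} = insert x {y \<in> V. E x y}"
    using assms E_sym by (auto simp: cl_def)
  then show ?thesis
    using regular[OF assms] finite_V E_irrefl by simp
qed

lemma common_cl:
  assumes "coclique S" "a \<in> S" "b \<in> S" "a \<noteq> b"
  shows "{v \<in> V. cl v a \<and> cl v b} = {v \<in> V. E v a \<and> E v b}"
  using assms E_sym by (auto simp: coclique_def cl_def)

lemma sum_cl:
  assumes "coclique S"
  shows "(\<Sum>v\<in>V. card {s\<in>S. cl v s}) = 26 * card S"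
proof -
  have "(\<Sum>v\<in>V. card {s\<in>S. cl v s}) = (\<Sum>s\<in>S. card {v\<in>V. cl v s})"
    using sum_card_swap[OF finite_V coclique_finite[OF assms]] .
  also have "\<dots> = (\<Sum>s\<in>S. 26)"
    using assms by (intro sum.cong) (auto simp: coclique_def card_cl)
  finally show ?thesis by simp
qed

text \<open>Three closed neighbourhoods cover at most 3 * 26 = 78 of the 80 vertices.\<close>

lemma coclique_extend:
  assumes S: "coclique S" and "card S \<le> 3"
  shows "\<exists>z\<in>V. \<forall>s\<in>S. \<not> cl z s"
proof (rule ccontr)
  assume "\<not> ?thesis"
  then have "card {s\<in>S. cl v s} \<ge> 1" if "v \<in> V" for v
    using that coclique_finite[OF S] card_gt_0_iff[of "{s\<in>S. cl v s}"] by fastforce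
  then have "(\<Sum>v\<in>V. 1) \<le> (\<Sum>v\<in>V. card {s\<in>S. cl v s})"
    by (intro sum_mono) simp
  then show False
    using sum_cl[OF S] card_V assms(2) by simp
qed

text \<open>
  With \<open>m v\<close> the number of members of \<open>S\<close> in the closed neighbourhood of \<open>v\<close>, the sum of
  \<open>(m v - 1) * (m v - 2)\<close> is at most \<open>100 - 2 * 130 + 2 * 80 = 0\<close>.
\<close>

lemma tight:
  assumes S: "coclique S" and "card S = 5"
  shows tight_cover: "\<And>v. v \<in> V \<Longrightarrow> card {s\<in>S. cl v s} \<in> {1, 2}"
    and tight_common: "\<And>a b. a \<in> S \<Longrightarrow> b \<in> S \<Longrightarrow> a \<noteq> b \<Longrightarrow> card {v \<in> V. E v a \<and> E v b} = 5"
proof -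
  note fin = coclique_finite[OF S]
  define m where "m v = int (card {s\<in>S. cl v s})" for v
  define P where "P = {p \<in> S \<times> S. fst p \<noteq> snd p}"
  define c where "c p = int (card {v \<in> V. E v (fst p) \<and> E v (snd p)})" for p
  have finP: "finite P" using fin by (simp add: P_def)
  have cardP: "card P = 20" using card_pairs[OF fin] assms(2) by (simp add: P_def)
  have c_le: "c p \<le> 5" if "p \<in> P" for p
    using that S common_le[of "fst p" "snd p"] by (auto simp: P_def c_def coclique_def subset_iff)
  have sum_m: "(\<Sum>v\<in>V. m v) = 130"
    using sum_cl[OF S] assms(2) unfolding m_def by (simp flip: of_nat_sum)
  \<comment> \<open>Second moment: both sides count ordered pairs of distinct members of
    \<open>S\<close> seen by \<open>v\<close>.\<close>
  have "m v * (m v - 1) = int (card {p\<in>P. cl v (fst p) \<and> cl v (snd p)})" for v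
  proof -
    have "{p\<in>P. cl v (fst p) \<and> cl v (snd p)} =
      {p \<in> {s\<in>S. cl v s} \<times> {s\<in>S. cl v s}. fst p \<noteq> snd p}"
      by (auto simp: P_def)
    then show ?thesis using card_pairs[of "{s\<in>S. cl v s}"] fin by (simp add: m_def)
  qed
  then have "(\<Sum>v\<in>V. m v * (m v - 1)) = int (\<Sum>v\<in>V. card {p\<in>P. cl v (fst p) \<and> cl v (snd p)})"
    by simp
  also have "\<dots> = int (\<Sum>p\<in>P. card {v\<in>V. cl v (fst p) \<and> cl v (snd p)})"
    by (simp only: sum_card_swap[OF finite_V finP])
  also have "\<dots> = (\<Sum>p\<in>P. c p)"
    unfolding of_nat_sum c_def
    by (intro sum.cong refl) (use common_cl[OF S] in \<open>auto simp: P_def\<close>)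
  finally have sum_mm: "(\<Sum>v\<in>V. m v * (m v - 1)) = (\<Sum>p\<in>P. c p)" .
  have "(\<Sum>v\<in>V. (m v - 1) * (m v - 2)) = (\<Sum>v\<in>V. m v * (m v - 1) - 2 * m v + 2)"
    by (intro sum.cong) (auto simp: algebra_simps)
  also have "\<dots> = (\<Sum>p\<in>P. c p) - 100"
    by (simp add: sum.distrib sum_subtractf sum_mm sum_m card_V flip: sum_distrib_left)
  also have "\<dots> = - (\<Sum>p\<in>P. 5 - c p)"
    by (simp add: sum_subtractf cardP)
  finally have eq: "(\<Sum>v\<in>V. (m v - 1) * (m v - 2)) + (\<Sum>p\<in>P. 5 - c p) = 0" by simp
  \<comment> \<open>No integer lies strictly between 1 and 2. Hence both sums in \<open>eq\<close>
    have nonnegative terms, and every term vanishes.\<close>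
  have nn: "(m v - 1) * (m v - 2) \<ge> 0" for v
    by (cases "m v \<le> 1") (auto simp: mult_nonneg_nonneg mult_nonpos_nonpos)
  have "(\<Sum>v\<in>V. (m v - 1) * (m v - 2)) \<ge> 0" "(\<Sum>p\<in>P. 5 - c p) \<ge> 0"
    using nn c_le by (auto intro!: sum_nonneg)
  then have 0: "(\<Sum>v\<in>V. (m v - 1) * (m v - 2)) = 0" "(\<Sum>p\<in>P. 5 - c p) = 0"
    using eq by auto
  show "card {s\<in>S. cl v s} \<in> {1, 2}" if "v \<in> V" for v
  proof -
    have "(m v - 1) * (m v - 2) = 0"
      using 0(1) nn finite_V that sum_nonneg_eq_0_iff[of V "\<lambda>v. (m v - 1) * (m v - 2)"] by blast
    then show ?thesis by (auto simp: m_def)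
  qed
  show "card {v \<in> V. E v a \<and> E v b} = 5" if "a \<in> S" "b \<in> S" "a \<noteq> b" for a b
  proof -
    have "5 - c (a, b) = 0"
      using 0(2) c_le finP that sum_nonneg_eq_0_iff[of P "\<lambda>p. 5 - c p"] by (force simp: P_def)
    then show ?thesis by (simp add: c_def)
  qed
qed

section \<open>Structure and exchanges of a tight 5-coclique\<close>

definition co5 :: "'a set \<Rightarrow> bool" where
  "co5 S \<longleftrightarrow> coclique S \<and> card S = 5"

definition priv :: "'a set \<Rightarrow> 'a \<Rightarrow> 'a set" where
  "priv S a = {v \<in> V. \<forall>s\<in>S. cl v s \<longleftrightarrow> s = a}"

definition dbl :: "'a set \<Rightarrow> 'a \<Rightarrow> 'a \<Rightarrow> 'a set" where
  "dbl S a b = {v \<in> V. \<forall>s\<in>S. cl v s \<longleftrightarrow> s = a \<or> s = b}"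

text \<open>Any two nonadjacent vertices of this set can replace \<open>a\<close> and
  \<open>b\<close> in a 5-coclique \<open>S\<close>.\<close>

definition rest :: "'a set \<Rightarrow> 'a \<Rightarrow> 'a \<Rightarrow> 'a set" where
  "rest S a b = {v \<in> V. \<forall>s\<in>S-{a, b}. \<not> cl v s}"

text \<open>
  A vertex \<open>t\<close> of \<open>dbl S a b\<close> that is not universal can replace \<open>a\<close> and \<open>b\<close> in \<open>S\<close>, together with some
  \<open>s\<close> of \<open>rest S a b\<close>, so it lies in a 5-coclique, which is again tight.
\<close>

definition universal :: "'a set \<Rightarrow> 'a \<Rightarrow> 'a \<Rightarrow> 'a \<Rightarrow> bool" where
  "universal S a b v \<longleftrightarrow> v \<in> dbl S a b \<and> (\<forall>u\<in>rest S a b. cl u v)"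

text \<open>Used with a private set \<open>priv S a\<close>. For a 4-coclique \<open>S\<close> the
  result will be one of four cliques covering the local graph.\<close>

definition complete_to :: "'a set \<Rightarrow> 'a set" where
  "complete_to A = {v \<in> V. \<forall>z\<in>A. cl z v}"

lemma co5_finite: "co5 S \<Longrightarrow> finite S"
  by (simp add: co5_def coclique_finite)

lemma co5_V: "co5 S \<Longrightarrow> a \<in> S \<Longrightarrow> a \<in> V"
  by (auto simp: co5_def coclique_def)

lemma co5_cl: "co5 S \<Longrightarrow> a \<in> S \<Longrightarrow> b \<in> S \<Longrightarrow> cl a b \<longleftrightarrow> a = b"
  unfolding co5_def by (metis coclique_cl)

lemma finite_sub [simp]: "finite (priv S a)" "finite (dbl S a b)" "finite (rest S a b)"
  using finite_V by (auto simp: priv_def dbl_def rest_def)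

lemma dbl_commute: "dbl S a b = dbl S b a"
  by (auto simp: dbl_def)

lemma rest_commute: "rest S a b = rest S b a"
  by (auto simp: rest_def)

lemma privD: "v \<in> priv S a \<Longrightarrow> s \<in> S \<Longrightarrow> cl v s \<longleftrightarrow> s = a"
  by (simp add: priv_def)

lemma dblD: "v \<in> dbl S a b \<Longrightarrow> s \<in> S \<Longrightarrow> cl v s \<longleftrightarrow> s = a \<or> s = b"
  by (simp add: dbl_def)

lemma rest_notin:
  assumes "z \<in> rest S a b"
  shows "z \<notin> S - {a, b}"
proof
  assume "z \<in> S - {a, b}"
  then have "\<not> cl z z" using assms unfolding rest_def by blast
  then show False by simp
qed

lemma universal_commute: "universal S a b v \<longleftrightarrow> universal S b a v"
  by (simp add: universal_def dbl_commute rest_commute)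

lemma covered:
  assumes "co5 S" "v \<in> V"
  shows "\<exists>s\<in>S. cl v s"
proof (rule ccontr)
  assume "\<not> ?thesis"
  then have "{s\<in>S. cl v s} = {}" by auto
  then show False using tight_cover[of S v] assms unfolding co5_def
    by (metis card.empty insertE singletonD zero_neq_one zero_neq_numeral)
qed

text \<open>The upper half of tightness; its force comes from applying it to the cocliques produced
  by exchanges.\<close>

lemma no_triple:
  assumes "co5 S" "v \<in> V" "a \<in> S" "b \<in> S" "c \<in> S" "cl v a" "cl v b" "cl v c"
    and "a \<noteq> b" "a \<noteq> c" "b \<noteq> c"
  shows False
proof -
  have "card {a, b, c} \<le> card {s\<in>S. cl v s}"
    using assms co5_finite by (intro card_mono) auto
  then show False using tight_cover[of S v] assms by (auto simp: co5_def)
qed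

lemma priv_refl: "co5 S \<Longrightarrow> a \<in> S \<Longrightarrow> a \<in> priv S a"
  using co5_cl co5_V by (auto simp: priv_def)

lemma exchange1:
  assumes S: "co5 S" and a: "a \<in> S" and z: "z \<in> priv S a"
  shows "co5 (insert z (S - {a}))"
proof -
  have nz: "\<not> cl z s" if "s \<in> S - {a}" for s
    using z that by (simp add: priv_def)
  then have "z \<notin> S - {a}"
    using cl_refl by blast
  moreover have "coclique (insert z (S - {a}))"
  proof (rule coclique_insert)
    show "coclique (S - {a})"
      using S coclique_subset[of S "S - {a}"] by (simp add: co5_def)
  qed (use z nz in \<open>auto simp: priv_def\<close>)
  moreover have "card (S - {a}) = 4"
    using S a by (simp add: co5_def)
  ultimately show ?thesis
    using co5_finite[OF S] by (simp add: co5_def)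
qed

lemma exchange2:
  assumes S: "co5 S" and ab: "a \<in> S" "b \<in> S" "a \<noteq> b"
    and z: "z \<in> rest S a b" and w: "w \<in> rest S a b" and zw: "\<not> cl z w"
  shows "co5 (insert z (insert w (S - {a, b})))"
proof -
  have nz: "\<not> cl z s" and nw: "\<not> cl w s" if "s \<in> S - {a, b}" for s
    using z w that by (auto simp: rest_def)
  have "w \<notin> S - {a, b}" "z \<notin> insert w (S - {a, b})"
    using nz nw zw cl_refl by blast+
  moreover have "coclique (insert w (S - {a, b}))"
  proof (rule coclique_insert)
    show "coclique (S - {a, b})"
      using S coclique_subset[of S "S - {a, b}"] by (simp add: co5_def)
  qed (use w nw in \<open>auto simp: rest_def\<close>)
  then have "coclique (insert z (insert w (S - {a, b})))"
    by (rule coclique_insert) (use z zw nz in \<open>auto simp: rest_def\<close>)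
  moreover have "card (S - {a, b}) = 3"
    using S ab co5_finite[OF S] by (simp add: co5_def card_Diff_subset)
  ultimately show ?thesis
    using co5_finite[OF S] by (simp add: co5_def)
qed

text \<open>After \<open>a\<close> is exchanged for \<open>z\<close>, an adjacency would let
  \<open>v\<close> see the three members \<open>z\<close>, \<open>b\<close>,
  \<open>c\<close>.\<close>

lemma priv_dbl_nonadj:
  assumes S: "co5 S" and "a \<in> S" "b \<in> S" "c \<in> S" "a \<noteq> b" "a \<noteq> c" "b \<noteq> c"
    and "z \<in> priv S a" "v \<in> dbl S b c"
  shows "\<not> cl v z"
proof
  assume "cl v z"
  moreover have "b \<noteq> z" "c \<noteq> z" using assms by (auto simp: priv_def)
  ultimately show False
    using no_triple[OF exchange1[OF S \<open>a \<in> S\<close> \<open>z \<in> priv S a\<close>], of v b c z] assms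
    by (auto simp: dbl_def)
qed

lemma dbl_notin:
  assumes "co5 S" "a \<in> S" "b \<in> S" "a \<noteq> b" "v \<in> dbl S a b"
  shows "v \<notin> S"
proof
  assume "v \<in> S"
  then have "v = a" "v = b"
    using assms(2,3,5) co5_cl[OF \<open>co5 S\<close> \<open>v \<in> S\<close>] by (auto simp: dbl_def)
  then show False using \<open>a \<noteq> b\<close> by simp
qed

text \<open>A common neighbour of \<open>a\<close> and \<open>b\<close> sees no third member of
  \<open>S\<close>.\<close>

lemma dbl_eq:
  assumes S: "co5 S" and ab: "a \<in> S" "b \<in> S" "a \<noteq> b"
  shows "dbl S a b = {v \<in> V. E v a \<and> E v b}"
proof (intro subset_antisym subsetI)
  fix v assume v: "v \<in> dbl S a b"
  then have "v \<noteq> a" "v \<noteq> b" "cl v a" "cl v b" "v \<in> V"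
    using dbl_notin[OF assms v] ab by (auto simp: dbl_def)
  then show "v \<in> {v \<in> V. E v a \<and> E v b}"
    by (simp add: cl_def)
next
  fix v assume v: "v \<in> {v \<in> V. E v a \<and> E v b}"
  then have "cl v s \<longleftrightarrow> s = a \<or> s = b" if "s \<in> S" for s
    using no_triple[OF S, of v a b s] ab that by (auto simp: cl_def)
  then show "v \<in> dbl S a b"
    using v by (simp add: dbl_def)
qed

lemma card_dbl: "co5 S \<Longrightarrow> a \<in> S \<Longrightarrow> b \<in> S \<Longrightarrow> a \<noteq> b \<Longrightarrow> card (dbl S a b) = 5"
  using dbl_eq[of S a b] tight_common[of S a b] by (simp add: co5_def)

lemma dbl_disjoint: "a \<in> S \<Longrightarrow> b \<in> S \<Longrightarrow> c \<in> S \<Longrightarrow> a \<noteq> b \<Longrightarrow> a \<noteq> c \<Longrightarrow> b \<noteq> c \<Longrightarrow> dbl S a c \<inter> dbl S b c = {}"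
  by (auto simp: dbl_def)

text \<open>The closed neighbourhood of \<open>a\<close> has 26 vertices, and the four disjoint sets
  \<open>dbl S a b\<close> take 4 * 5 = 20 of them.\<close>

lemma card_priv:
  assumes S: "co5 S" and a: "a \<in> S"
  shows "card (priv S a) = 6"
proof -
  have eq: "{v \<in> V. cl v a} = priv S a \<union> (\<Union>b\<in>S - {a}. dbl S a b)"
  proof (intro subset_antisym subsetI)
    fix v assume v: "v \<in> {v \<in> V. cl v a}"
    show "v \<in> priv S a \<union> (\<Union>b\<in>S - {a}. dbl S a b)"
    proof (cases "\<exists>b\<in>S - {a}. cl v b")
      case True
      then obtain b where b: "b \<in> S" "b \<noteq> a" "cl v b" by auto
      then have "v \<in> dbl S a b"
        using no_triple[OF S, of v a b] a v by (auto simp: dbl_def)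
      then show ?thesis using b by auto
    qed (use v a in \<open>auto simp: priv_def\<close>)
  qed (use a in \<open>auto simp: priv_def dbl_def\<close>)
  have "card (\<Union>b\<in>S - {a}. dbl S a b) = (\<Sum>b\<in>S - {a}. card (dbl S a b))"
  proof (rule card_UN_disjoint)
    show "\<forall>i\<in>S - {a}. \<forall>j\<in>S - {a}. i \<noteq> j \<longrightarrow> dbl S a i \<inter> dbl S a j = {}"
      using a by (auto simp: dbl_def)
  qed (use co5_finite[OF S] in simp_all)
  also have "\<dots> = (\<Sum>b\<in>S - {a}. 5)"
    using card_dbl[OF S a] by (intro sum.cong) auto
  also have "\<dots> = 20"
    using S a co5_finite[OF S] by (simp add: co5_def)
  finally have "card (\<Union>b\<in>S - {a}. dbl S a b) = 20" .
  moreover have "priv S a \<inter> (\<Union>b\<in>S - {a}. dbl S a b) = {}"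
    using a by (auto simp: priv_def dbl_def)
  ultimately have "card {v \<in> V. cl v a} = card (priv S a) + 20"
    unfolding eq using co5_finite[OF S] by (subst card_Un_disjoint) auto
  then show ?thesis
    using card_cl[OF co5_V[OF S a]] by simp
qed

lemma rest_eq:
  assumes S: "co5 S" and "a \<in> S" "b \<in> S" "a \<noteq> b"
  shows "rest S a b = priv S a \<union> priv S b \<union> dbl S a b"
proof (intro subset_antisym subsetI)
  fix v assume v: "v \<in> rest S a b"
  then show "v \<in> priv S a \<union> priv S b \<union> dbl S a b"
    using covered[OF S, of v] assms by (auto simp: rest_def priv_def dbl_def)
qed (use assms in \<open>auto simp: rest_def priv_def dbl_def\<close>)

lemma card_rest:
  assumes S: "co5 S" and ab: "a \<in> S" "b \<in> S" "a \<noteq> b"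
  shows "card (rest S a b) = 17"
proof -
  have "priv S a \<inter> priv S b = {}" "(priv S a \<union> priv S b) \<inter> dbl S a b = {}"
    using ab by (auto simp: priv_def dbl_def)
  then show ?thesis
    unfolding rest_eq[OF assms] using assms
    by (simp add: card_Un_disjoint card_priv card_dbl)
qed

text \<open>If \<open>z\<close> and \<open>t\<close> were nonadjacent, they could replace
  \<open>a\<close> and \<open>c\<close>, and \<open>v\<close> would see the three members
  \<open>z\<close>, \<open>t\<close>, \<open>b\<close>.\<close>

lemma common_clique:
  assumes S: "co5 S" and "a \<in> S" "c \<in> S" "b \<in> S" "a \<noteq> c" "b \<noteq> a" "b \<noteq> c"
    and z: "z \<in> rest S a c" and t: "t \<in> rest S a c" and v: "v \<in> V" "cl v z" "cl v t" "cl v b"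
  shows "cl z t"
proof (rule ccontr)
  assume "\<not> cl z t"
  then have "co5 (insert z (insert t (S - {a, c})))"
    using exchange2 assms by blast
  moreover have "\<not> cl z b" "\<not> cl t b"
    using z t assms by (auto simp: rest_def)
  then have "z \<noteq> t" "b \<noteq> z" "b \<noteq> t"
    using \<open>\<not> cl z t\<close> cl_refl by blast+
  ultimately show False
    using no_triple[of "insert z (insert t (S - {a, c}))" v z t b] assms by auto
qed

text \<open>All vertices counted are common neighbours of \<open>t\<close> and \<open>c\<close>,
  which are nonadjacent.\<close>

lemma dbl_nbrs_le:
  assumes S: "co5 S" and abc: "a \<in> S" "b \<in> S" "c \<in> S" "a \<noteq> b" "a \<noteq> c" "b \<noteq> c"
    and t: "t \<in> dbl S a b"
  shows "card {v \<in> dbl S a c \<union> dbl S b c. E v t} \<le> 5"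
proof -
  have "card {v \<in> dbl S a c \<union> dbl S b c. E v t} \<le> card {v \<in> V. E v t \<and> E v c}"
    using finite_V dbl_eq[OF S] abc by (intro card_mono) auto
  also have "\<dots> \<le> 5"
    using t abc co5_V[OF S] by (intro common_le) (auto simp: dbl_def cl_def)
  finally show ?thesis .
qed

text \<open>Some \<open>s\<close> in \<open>rest S a b\<close> misses \<open>t\<close>. Exchanging
  \<open>a\<close>, \<open>b\<close> for \<open>s\<close>, \<open>t\<close> gives a 5-coclique
  containing \<open>t\<close> and \<open>c\<close>, which therefore have exactly 5 common
  neighbours. Such a neighbour is not private to \<open>c\<close>, sees no member of
  \<open>S\<close> other than \<open>a\<close>, \<open>b\<close>, \<open>c\<close>, and does not see
  both \<open>a\<close> and \<open>b\<close>; so it lies in one of the two sets.\<close>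

lemma dbl_nbrs_eq:
  assumes S: "co5 S" and abc: "a \<in> S" "b \<in> S" "c \<in> S" "a \<noteq> b" "a \<noteq> c" "b \<noteq> c"
    and t: "t \<in> dbl S a b" and "\<not> universal S a b t"
  shows "card {v \<in> dbl S a c \<union> dbl S b c. E v t} = 5"
proof -
  obtain s where s: "s \<in> rest S a b" "\<not> cl s t"
    using assms by (auto simp: universal_def)
  have t': "t \<in> rest S a b" using t by (auto simp: rest_def dbl_def)
  define T where "T = insert s (insert t (S - {a, b}))"
  have T: "co5 T" unfolding T_def using exchange2 S abc s t' by blast
  have inT: "t \<in> T" "c \<in> T" using abc by (auto simp: T_def)
  have tc: "t \<noteq> c" using t abc by (auto simp: dbl_def)
  have "{v \<in> dbl S a c \<union> dbl S b c. E v t} = {v \<in> V. E v t \<and> E v c}"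
  proof (intro subset_antisym subsetI)
    fix v assume v: "v \<in> {v \<in> V. E v t \<and> E v c}"
    have tS: "t \<notin> S" using dbl_notin[OF S] t abc by blast
    have other: "\<not> cl v d" if "d \<in> S" "d \<noteq> a" "d \<noteq> b" "d \<noteq> c" for d
      using no_triple[OF T, of v t c d] v inT that tc tS by (auto simp: T_def cl_def)
    have "v \<notin> priv S c"
      using priv_dbl_nonadj[OF S \<open>c \<in> S\<close> \<open>a \<in> S\<close> \<open>b \<in> S\<close>, of v t] abc t v E_sym by (auto simp: cl_def)
    moreover have "\<not> (cl v a \<and> cl v b)"
      using no_triple[OF S, of v a b c] v abc by (auto simp: cl_def)
    moreover have vc: "v \<in> V" "cl v c" "E v t" using v by (auto simp: cl_def)
    ultimately consider "cl v a" "\<not> cl v b" | "cl v b" "\<not> cl v a"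
      using other unfolding priv_def by blast
    then have "v \<in> dbl S a c \<or> v \<in> dbl S b c"
    proof cases
      case 1
      then have "\<forall>s\<in>S. cl v s \<longleftrightarrow> s = a \<or> s = c" using other vc by blast
      then show ?thesis using vc by (simp add: dbl_def)
    next
      case 2
      then have "\<forall>s\<in>S. cl v s \<longleftrightarrow> s = b \<or> s = c" using other vc by blast
      then show ?thesis using vc by (simp add: dbl_def)
    qed
    then show "v \<in> {v \<in> dbl S a c \<union> dbl S b c. E v t}" using vc by simp
  qed (use dbl_eq[OF S] abc in auto)
  then show ?thesis
    using tight_common[of T t c] T inT tc by (simp add: co5_def)
qed

text \<open>A nonadjacent pair would have all of \<open>A\<close>, more than 5 vertices, as common
  neighbours.\<close>

lemma complete_adjacent:
  assumes A: "5 < card A" "A \<subseteq> V"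
    and u: "u \<in> complete_to A" "u \<notin> A" and v: "v \<in> complete_to A" "v \<notin> A"
  shows "cl u v"
proof (rule ccontr)
  assume "\<not> cl u v"
  then have "card {z \<in> V. E z u \<and> E z v} \<le> 5"
    using u v by (intro common_le) (auto simp: complete_to_def cl_def)
  moreover have "card A \<le> card {z \<in> V. E z u \<and> E z v}"
    using A u v finite_V by (intro card_mono) (auto simp: complete_to_def cl_def)
  ultimately show False using A by simp
qed

text \<open>
  The numbers of edges between any two of the three sets \<open>dbl\<close> sum to 25 in pairs, so they all equal 25/2.
\<close>

lemma parity:
  assumes S: "co5 S" and abc: "a \<in> S" "b \<in> S" "c \<in> S" "a \<noteq> b" "a \<noteq> c" "b \<noteq> c"
    and nou: "\<And>t. \<not> universal S a b t" "\<And>t. \<not> universal S a c t" "\<And>t. \<not> universal S b c t"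
  shows False
proof -
  define e where "e P R = (\<Sum>t\<in>P. card {v\<in>R. E v t})" for P R
  have e_commute: "e P R = e R P" if "finite P" "finite R" for P R
  proof -
    have "{t\<in>P. E v t} = {t\<in>P. E t v}" for v
      using E_sym by auto
    then show ?thesis
      unfolding e_def using sum_card_swap[OF that, of "\<lambda>t v. E v t"] by simp
  qed
  have sum25: "e (dbl S x y) (dbl S x z) + e (dbl S x y) (dbl S y z) = 25"
    if xyz: "x \<in> S" "y \<in> S" "z \<in> S" "x \<noteq> y" "x \<noteq> z" "y \<noteq> z" and nxy: "\<And>t. \<not> universal S x y t" for x y z
  proof -
    have "card {v\<in>dbl S x z. E v t} + card {v\<in>dbl S y z. E v t} = 5" if t: "t \<in> dbl S x y" for t
    proof -
      have "{v\<in>dbl S x z. E v t} \<inter> {v\<in>dbl S y z. E v t} = {}"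
        using dbl_disjoint[OF xyz] by auto
      then have "card ({v\<in>dbl S x z. E v t} \<union> {v\<in>dbl S y z. E v t}) =
          card {v\<in>dbl S x z. E v t} + card {v\<in>dbl S y z. E v t}"
        by (intro card_Un_disjoint) auto
      moreover have "{v\<in>dbl S x z. E v t} \<union> {v\<in>dbl S y z. E v t} = {v\<in>dbl S x z \<union> dbl S y z. E v t}"
        by auto
      ultimately show ?thesis
        using dbl_nbrs_eq[OF S xyz t nxy] by simp
    qed
    \<comment> \<open>Five vertices \<open>t\<close> with five neighbours each.\<close>
    then show ?thesis
      using card_dbl[OF S xyz(1,2,4)] by (simp add: e_def flip: sum.distrib)
  qed
  have "e (dbl S a b) (dbl S a c) + e (dbl S a b) (dbl S b c) = 25"
    using sum25[of a b c] abc nou by simp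
  moreover have "e (dbl S a c) (dbl S a b) + e (dbl S a c) (dbl S b c) = 25"
    using sum25[of a c b] abc nou by (simp add: dbl_commute[of S c b])
  moreover have "e (dbl S b c) (dbl S a b) + e (dbl S b c) (dbl S a c) = 25"
    using sum25[of b c a] abc nou by (simp add: dbl_commute[of S b a] dbl_commute[of S c a])
  moreover have "e (dbl S a c) (dbl S a b) = e (dbl S a b) (dbl S a c)"
    "e (dbl S b c) (dbl S a b) = e (dbl S a b) (dbl S b c)"
    "e (dbl S b c) (dbl S a c) = e (dbl S a c) (dbl S b c)"
    by (auto intro: e_commute)
  ultimately have "2 * e (dbl S a b) (dbl S a c) = 25" by simp
  then have "even (25::nat)" by (metis dvd_triv_left)
  then show False by simp
qed

section \<open>Universal vertices and nonadjacency inside \<open>rest S a b\<close>\<close>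

lemma card_nonadj:
  assumes S: "co5 S" and ab: "a \<in> S" "b \<in> S" "a \<noteq> b"
    and z: "z \<in> rest S a b" and w: "w \<in> rest S a b" and zw: "\<not> cl z w"
  shows "card {u \<in> rest S a b. \<not> cl z u} = 6"
proof -
  define T where "T = insert z (insert w (S - {a, b}))"
  have T: "co5 T" unfolding T_def using exchange2[OF S ab z w zw] .
  have w_notin: "w \<notin> S - {a, b}" "z \<notin> S - {a, b}" "z \<noteq> w"
    using rest_notin[OF z] rest_notin[OF w] zw cl_refl by blast+
  \<comment> \<open>A vertex of \<open>rest S a b\<close> sees none of \<open>S - {a, b}\<close>; if
    it also misses \<open>z\<close>, only \<open>w\<close> is left to cover it in
    \<open>T\<close>.\<close>
  have "{u \<in> rest S a b. \<not> cl z u} = priv T w"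
  proof (intro subset_antisym subsetI)
    fix u assume u: "u \<in> {u \<in> rest S a b. \<not> cl z u}"
    then have "u \<in> V" by (simp add: rest_def)
    then have "\<exists>s\<in>T. cl u s" by (rule covered[OF T])
    then have "cl u w"
      using u by (auto simp: T_def rest_def cl_commute)
    then show "u \<in> priv T w"
      using u w_notin by (auto simp: T_def priv_def rest_def cl_commute)
  next
    fix u assume u: "u \<in> priv T w"
    then show "u \<in> {u \<in> rest S a b. \<not> cl z u}"
      using w_notin by (auto simp: T_def priv_def rest_def cl_commute)
  qed
  then show ?thesis
    using card_priv[OF T, of w] by (simp add: T_def)
qed

text \<open>
  A universal vertex \<open>v\<close> has 9 neighbours outside \<open>rest S a b\<close>, and at most 5 in common with each of the
  three other members of \<open>S\<close>, so some neighbour \<open>p\<close> sees only one of these three. It then sees exactly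
  one end of each nonadjacent pair in \<open>rest S a b\<close>: the complement of \<open>rest S a b\<close> is bipartite.
\<close>

lemma universal_splitter:
  assumes S: "co5 S" and ab: "a \<in> S" "b \<in> S" "a \<noteq> b" and v: "universal S a b v"
  obtains p c where "p \<in> V" "E p v" "c \<in> S - {a, b}" "cl p c"
    "\<And>d. d \<in> S - {a, b} \<Longrightarrow> cl p d \<Longrightarrow> d = c"
proof -
  have vD: "v \<in> dbl S a b" and vX: "v \<in> rest S a b" "v \<in> V"
    using v by (auto simp: universal_def dbl_def rest_def)
  define R where "R = S - {a, b}"
  have R: "finite R" "card R = 3"
    using S ab co5_finite[OF S] by (auto simp: R_def co5_def card_Diff_subset)
  define O' where "O' = {u \<in> V - rest S a b. E u v}"
  have finO: "finite O'" using finite_V by (simp add: O'_def)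
  have sub: "rest S a b \<subseteq> V" by (auto simp: rest_def)
  have "{y \<in> V. E v y} = (rest S a b - {v}) \<union> O'"
    using v sub E_sym E_irrefl by (auto simp: universal_def O'_def cl_def)
  moreover have "card ((rest S a b - {v}) \<union> O') = card (rest S a b - {v}) + card O'"
    using finO by (intro card_Un_disjoint) (auto simp: O'_def)
  moreover have "card (rest S a b - {v}) = 16"
    using card_rest[OF S ab] vX by simp
  ultimately have cardO: "card O' = 9"
    using regular[OF vX(2)] by simp
  have "card {u \<in> O'. cl u s} \<le> 5" if "s \<in> R" for s
  proof -
    have s: "s \<in> V" "\<not> cl v s"
      using that S vX co5_V by (auto simp: R_def rest_def)
    then have "{u \<in> O'. cl u s} \<subseteq> {u \<in> V. E u v \<and> E u s}"
      using E_sym by (auto simp: O'_def cl_def)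
    then have "card {u \<in> O'. cl u s} \<le> card {u \<in> V. E u v \<and> E u s}"
      using finite_V by (intro card_mono) auto
    also have "\<dots> \<le> 5"
      using s vX by (intro common_le) (auto simp: cl_def)
    finally show ?thesis .
  qed
  then have "(\<Sum>s\<in>R. card {u \<in> O'. cl u s}) \<le> 15"
    using sum_bounded_above[of R "\<lambda>s. card {u \<in> O'. cl u s}" 5] R by simp
  then have le: "(\<Sum>u\<in>O'. card {s \<in> R. cl u s}) \<le> 15"
    by (simp add: sum_card_swap[OF finO R(1)])
  \<comment> \<open>Otherwise the nine vertices would contribute at least 18 to a sum of at most
    15.\<close>
  have "\<exists>p\<in>O'. card {s \<in> R. cl p s} \<le> 1"
  proof (rule ccontr)
    assume "\<not> ?thesis"
    then have "Suc 1 \<le> card {s \<in> R. cl u s}" if "u \<in> O'" for u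
      using that by (auto simp: not_le Suc_le_eq)
    then have "(\<Sum>u\<in>O'. card {s \<in> R. cl u s}) \<ge> (\<Sum>u\<in>O'. Suc 1)"
      by (intro sum_mono)
    then show False using le cardO by simp
  qed
  then obtain p where p: "p \<in> O'" "card {s \<in> R. cl p s} \<le> 1" by blast
  \<comment> \<open>Lying outside \<open>rest S a b\<close>, the vertex \<open>p\<close> sees at
    least one member of \<open>R\<close>.\<close>
  then obtain c where c: "c \<in> R" "cl p c"
    by (auto simp: O'_def rest_def R_def)
  have only: "d = c" if "d \<in> R" "cl p d" for d
  proof (rule ccontr)
    assume "d \<noteq> c"
    then have "card {c, d} \<le> card {s \<in> R. cl p s}"
      using that c R by (intro card_mono) auto
    then show False using \<open>d \<noteq> c\<close> p by simp
  qed
  show thesis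
  proof (rule that[of p c])
    show "p \<in> V" "E p v" using p(1) by (auto simp: O'_def)
  qed (use c only in \<open>unfold R_def, blast+\<close>)
qed

text \<open>The colouring is \<open>cl p\<close> for the \<open>p\<close> of
  \<open>universal_splitter\<close>. Let \<open>z\<close>, \<open>w\<close> replace
  \<open>a\<close>, \<open>b\<close>. Seeing both, \<open>p\<close> would see the three members
  \<open>z\<close>, \<open>w\<close>, \<open>c\<close>. Seeing neither, \<open>p\<close> would be
  private to \<open>c\<close> while \<open>v\<close> sees exactly \<open>z\<close> and
  \<open>w\<close>, so \<open>priv_dbl_nonadj\<close> would separate the neighbours \<open>p\<close>
  and \<open>v\<close>.\<close>

lemma universal_bipartite:
  assumes S: "co5 S" and ab: "a \<in> S" "b \<in> S" "a \<noteq> b" and v: "universal S a b v"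
  obtains f where "\<And>z w. z \<in> rest S a b \<Longrightarrow> w \<in> rest S a b \<Longrightarrow> \<not> cl z w \<Longrightarrow> f z \<longleftrightarrow> \<not> f w"
proof -
  obtain p c where p: "p \<in> V" "E p v" "c \<in> S - {a, b}" "cl p c"
    and only: "\<And>d. d \<in> S - {a, b} \<Longrightarrow> cl p d \<Longrightarrow> d = c"
    using universal_splitter[OF assms] by metis
  have vD: "v \<in> dbl S a b" "v \<in> V" and vX: "\<And>u. u \<in> rest S a b \<Longrightarrow> cl u v"
    using v by (auto simp: universal_def dbl_def)
  have "cl p z \<longleftrightarrow> \<not> cl p w"
    if z: "z \<in> rest S a b" and w: "w \<in> rest S a b" and zw: "\<not> cl z w" for z w
  proof -
    define T where "T = insert z (insert w (S - {a, b}))"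
    have T: "co5 T" unfolding T_def using exchange2[OF S ab z w zw] .
    have neq: "z \<noteq> w" "c \<noteq> z" "c \<noteq> w"
      using p(3) rest_notin[OF z] rest_notin[OF w] zw cl_refl by blast+
    have inT: "z \<in> T" "w \<in> T" "c \<in> T" using p by (auto simp: T_def)
    have "\<not> (cl p z \<and> cl p w)"
      using no_triple[OF T \<open>p \<in> V\<close> inT] p neq by blast
    moreover have "cl p z \<or> cl p w"
    proof (rule ccontr)
      assume "\<not> ?thesis"
      then have "\<forall>s\<in>T. cl p s \<longleftrightarrow> s = c"
        unfolding T_def using p only neq by blast
      then have "p \<in> priv T c"
        using p by (simp add: priv_def)
      moreover have "cl v z" "cl v w" "\<forall>s\<in>S - {a, b}. \<not> cl v s"
        using vX[OF z] vX[OF w] cl_commute vD by (auto simp: dbl_def)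
      then have "\<forall>s\<in>T. cl v s \<longleftrightarrow> s = z \<or> s = w"
        unfolding T_def using rest_notin[OF z] rest_notin[OF w] by blast
      then have "v \<in> dbl T z w"
        using vD by (simp add: dbl_def)
      ultimately have "\<not> cl v p"
        using priv_dbl_nonadj[OF T inT(3,1,2)] neq by blast
      then show False
        using \<open>E p v\<close> E_sym by (auto simp: cl_def)
    qed
    ultimately show ?thesis by blast
  qed
  then show thesis by (rule that)
qed

text \<open>On the vertices \<open>N\<close> of \<open>rest S a b\<close> that have a nonneighbour
  there, nonadjacency is bipartite and regular of degree 6, so the two halves are equal. As
  \<open>v\<close> is not in \<open>N\<close>, at most 17 - 1 = 16 vertices remain, 8 in each half.
  The half of \<open>b\<close> contains the 6 vertices of \<open>priv S b\<close> and every vertex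
  of \<open>dbl S a b\<close> that misses something in \<open>priv S a\<close>, which leaves room
  for 2 of the latter.\<close>

lemma universal_complete:
  assumes S: "co5 S" and ab: "a \<in> S" "b \<in> S" "a \<noteq> b" and v: "universal S a b v"
  shows "card (dbl S a b - complete_to (priv S a)) \<le> 2"
proof -
  obtain f where f: "\<And>z w. z \<in> rest S a b \<Longrightarrow> w \<in> rest S a b \<Longrightarrow> \<not> cl z w \<Longrightarrow> f z \<longleftrightarrow> \<not> f w"
    using universal_bipartite[OF assms] by metis
  define X where "X = rest S a b"
  have finX: "finite X" by (simp add: X_def)
  define N where "N = {z \<in> X. \<exists>w\<in>X. \<not> cl z w}"
  define A where "A = {z \<in> N. f z}"
  define B where "B = {z \<in> N. \<not> f z}"
  have fin: "finite A" "finite B" "finite N" using finX by (auto simp: A_def B_def N_def)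
  have deg: "card {u \<in> X. \<not> cl z u} = 6" if "z \<in> N" for z
    using that card_nonadj[OF S ab] by (auto simp: N_def X_def)
  have "card {u \<in> B. \<not> cl z u} = 6" if "z \<in> A" for z
  proof -
    have "{u \<in> B. \<not> cl z u} = {u \<in> X. \<not> cl z u}"
      using that f by (auto simp: A_def B_def N_def X_def cl_commute)
    then show ?thesis using deg[of z] that by (simp add: A_def)
  qed
  moreover have "card {u \<in> A. \<not> cl u z} = 6" if "z \<in> B" for z
  proof -
    have "{u \<in> A. \<not> cl u z} = {u \<in> X. \<not> cl z u}"
      using that f by (auto simp: A_def B_def N_def X_def cl_commute)
    then show ?thesis using deg[of z] that by (simp add: B_def)
  qed
  ultimately have "card A = card B"
    using sum_card_swap[OF fin(1,2), of "\<lambda>z u. \<not> cl z u"] by simp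
  moreover have "card A + card B \<le> 16"
  proof -
    have "card A + card B = card (A \<union> B)"
      using fin by (subst card_Un_disjoint) (auto simp: A_def B_def)
    also have "\<dots> \<le> card (X - {v})"
      using v finX by (intro card_mono) (auto simp: A_def B_def N_def X_def universal_def cl_commute)
    also have "v \<in> X" using v by (auto simp: X_def universal_def rest_def dbl_def)
    then have "card (X - {v}) = 16"
      using card_rest[OF S ab] finX by (simp add: X_def)
    finally show ?thesis .
  qed
  ultimately have le8: "card {z \<in> N. f z \<longleftrightarrow> f b} \<le> 8"
    by (cases "f b") (simp_all add: A_def B_def)
  have sub: "priv S a \<subseteq> X" "priv S b \<subseteq> X" "dbl S a b \<subseteq> X" "a \<in> X" "b \<in> X"
    using rest_eq[OF S ab] priv_refl[OF S] ab by (auto simp: X_def)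
  have fa: "f z \<longleftrightarrow> \<not> f b" if "z \<in> priv S a" for z
    using f[of z b] that sub ab by (auto simp: X_def priv_def)
  have fb: "f z \<longleftrightarrow> f b" "z \<in> N" if "z \<in> priv S b" for z
    using f[of z a] f[of b a] that sub ab co5_cl[OF S, of b a] by (auto simp: X_def N_def priv_def)
  have fD: "f z \<longleftrightarrow> f b" "z \<in> N" if z: "z \<in> dbl S a b - complete_to (priv S a)" for z
  proof -
    obtain u where u: "u \<in> priv S a" "\<not> cl z u"
      using z by (auto simp: complete_to_def dbl_def cl_commute)
    then show "f z \<longleftrightarrow> f b" "z \<in> N"
      using f[of z u] fa z sub by (auto simp: X_def N_def)
  qed
  have "card (priv S b \<union> (dbl S a b - complete_to (priv S a))) \<le> card {z \<in> N. f z \<longleftrightarrow> f b}"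
    using fin fb fD by (intro card_mono) auto
  moreover have "card (priv S b \<union> (dbl S a b - complete_to (priv S a))) =
      card (priv S b) + card (dbl S a b - complete_to (priv S a))"
  proof (rule card_Un_disjoint)
    show "priv S b \<inter> (dbl S a b - complete_to (priv S a)) = {}"
      using ab by (auto simp: priv_def dbl_def)
  qed simp_all
  ultimately show ?thesis
    using card_priv[OF S ab(2)] le8 by simp
qed

section \<open>Pairs with a universal vertex form a matching on \<open>S\<close>\<close>

lemma universal_adjacent_aux:
  assumes S: "co5 S" and abc: "a \<in> S" "b \<in> S" "c \<in> S" "a \<noteq> b" "a \<noteq> c" "b \<noteq> c"
    and v: "universal S a b v" and w: "universal S b c w"
  shows "card (dbl S a c \<inter> complete_to (priv S a)) \<le> 2"
proof -
  let ?A = "dbl S a c \<inter> complete_to (priv S a)" and ?B = "dbl S b c \<inter> complete_to (priv S b)"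
  have vD: "v \<in> dbl S a b" and vX: "\<And>u. u \<in> rest S a b \<Longrightarrow> cl u v"
    using v by (auto simp: universal_def)
  have "priv S a \<subseteq> rest S a b" "priv S b \<subseteq> rest S a b"
    using rest_eq[OF S abc(1,2,4)] by auto
  then have vL: "v \<in> complete_to (priv S a)" "v \<in> complete_to (priv S b)"
    using vX vD by (auto simp: complete_to_def dbl_def)
  have notin: "v \<notin> priv S a" "v \<notin> priv S b"
    using dblD[OF vD] privD[of v S] abc by blast+
  \<comment> \<open>\<open>u\<close> and \<open>v\<close> are both complete to a private set, which
    has 6 vertices, so \<open>complete_adjacent\<close> applies.\<close>
  have "E u v" if "u \<in> ?A \<union> ?B" for u
  proof -
    have u: "cl u c" "cl u a \<or> cl u b"
      using that abc dblD[of u S] by blast+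
    then have "u \<noteq> v" using dblD[OF vD] abc by blast
    moreover have "u \<notin> priv S a" "u \<notin> priv S b"
      using u privD[of u S] abc by blast+
    then have "cl u v"
      using complete_adjacent[of "priv S a" u v] complete_adjacent[of "priv S b" u v] that vL notin
        card_priv[OF S abc(1)] card_priv[OF S abc(2)] by (auto simp: priv_def)
    ultimately show ?thesis by (simp add: cl_def)
  qed
  \<comment> \<open>The disjoint sets \<open>?A\<close> and \<open>?B\<close> consist of neighbours
    of \<open>v\<close>, so they have at most 5 vertices together. Because of \<open>w\<close>, at
    least 3 of the 5 vertices of \<open>dbl S b c\<close> are in \<open>?B\<close>, which leaves at
    most 2 for \<open>?A\<close>.\<close>
  then have "card (?A \<union> ?B) \<le> card {u \<in> dbl S a c \<union> dbl S b c. E u v}"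
    by (intro card_mono) auto
  also have "\<dots> \<le> 5" by (rule dbl_nbrs_le[OF S abc vD])
  also have "card (?A \<union> ?B) = card ?A + card ?B"
    using dbl_disjoint[OF abc] by (intro card_Un_disjoint) auto
  finally have "card ?A + card ?B \<le> 5" .
  moreover have "card (dbl S b c) = card (dbl S b c - complete_to (priv S b)) + card ?B"
    using card_Int_Diff[of "dbl S b c" "complete_to (priv S b)"] by simp
  ultimately show ?thesis
    using universal_complete[OF S abc(2,3,6) w] card_dbl[OF S abc(2,3,6)] by simp
qed

text \<open>For \<open>z\<close> in \<open>priv S a\<close>, the vertex \<open>v\<close> sees
  \<open>z\<close>, \<open>t\<close> and the member \<open>b\<close>, so
  \<open>common_clique\<close> makes \<open>z\<close> and \<open>t\<close> adjacent.\<close>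

lemma dbl_transfer:
  assumes S: "co5 S" and abc: "a \<in> S" "b \<in> S" "c \<in> S" "a \<noteq> b" "a \<noteq> c" "b \<noteq> c"
    and v: "v \<in> dbl S a b" "v \<in> complete_to (priv S a)" and t: "t \<in> dbl S a c" "E v t"
  shows "t \<in> complete_to (priv S a)"
proof -
  have "cl z t" if z: "z \<in> priv S a" for z
  proof (rule common_clique[OF S abc(1,3,2) abc(5)])
    show "z \<in> rest S a c" "t \<in> rest S a c"
      using z t rest_eq[OF S abc(1,3,5)] by auto
    show "v \<in> V" "cl v z" "cl v t" "cl v b"
      using v z t abc by (auto simp: complete_to_def dbl_def cl_commute cl_def E_sym)
  qed (use abc in auto)
  then show ?thesis
    using t by (simp add: complete_to_def dbl_def)
qed

text \<open>At most 2 + 2 of the 5 vertices of \<open>dbl S a c\<close> are complete to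
  \<open>priv S a\<close> or to \<open>priv S c\<close>, so some \<open>t\<close> is complete to
  neither and hence not universal. Its 5 neighbours in \<open>dbl S a b\<close> and
  \<open>dbl S c b\<close> fail to be complete to the respective private sets by
  \<open>dbl_transfer\<close>, but only 2 + 2 vertices fail.\<close>

lemma universal_nonadjacent:
  assumes S: "co5 S" and abc: "a \<in> S" "b \<in> S" "c \<in> S" "a \<noteq> b" "a \<noteq> c" "b \<noteq> c"
    and v: "universal S a b v" and w: "universal S b c w"
  shows False
proof -
  let ?La = "complete_to (priv S a)" and ?Lc = "complete_to (priv S c)"
  note [simp] = dbl_commute[of S c] dbl_commute[of S b a]
  have w': "universal S c b w" and v': "universal S b a v"
    using v w universal_commute by blast+
  have "card (dbl S a c \<inter> ?La) \<le> 2"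
    using universal_adjacent_aux[OF S abc v w] .
  moreover have "card (dbl S a c \<inter> ?Lc) \<le> 2"
    using universal_adjacent_aux[OF S abc(3,2,1) _ _ _ w' v'] abc by (simp add: dbl_commute)
  moreover have "card ((dbl S a c \<inter> ?La) \<union> (dbl S a c \<inter> ?Lc))
      \<le> card (dbl S a c \<inter> ?La) + card (dbl S a c \<inter> ?Lc)"
    by (rule card_Un_le)
  moreover have "card (dbl S a c) = 5"
    using card_dbl[OF S abc(1,3,5)] .
  ultimately have "\<not> dbl S a c \<subseteq> (dbl S a c \<inter> ?La) \<union> (dbl S a c \<inter> ?Lc)"
    using card_mono[of "(dbl S a c \<inter> ?La) \<union> (dbl S a c \<inter> ?Lc)" "dbl S a c"] by fastforce
  then obtain t where t: "t \<in> dbl S a c" "t \<notin> ?La" "t \<notin> ?Lc" by blast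
  have "\<not> universal S a c t"
  proof
    assume "universal S a c t"
    moreover have "priv S a \<subseteq> rest S a c"
      using rest_eq[OF S abc(1,3,5)] by auto
    ultimately have "t \<in> ?La"
      by (auto simp: universal_def complete_to_def dbl_def)
    then show False using t by simp
  qed
  then have "card {u \<in> dbl S a b \<union> dbl S c b. E u t} = 5"
    using dbl_nbrs_eq[OF S abc(1,3,2) _ _ _ t(1)] abc by simp
  moreover have "{u \<in> dbl S a b \<union> dbl S c b. E u t} \<subseteq> (dbl S a b - ?La) \<union> (dbl S c b - ?Lc)"
  proof
    fix u assume u: "u \<in> {u \<in> dbl S a b \<union> dbl S c b. E u t}"
    have "t \<in> dbl S c a" using t dbl_commute by blast
    then show "u \<in> (dbl S a b - ?La) \<union> (dbl S c b - ?Lc)"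
      using dbl_transfer[OF S abc, of u t] dbl_transfer[OF S abc(3,2,1), of u t] u t abc by blast
  qed
  then have "card {u \<in> dbl S a b \<union> dbl S c b. E u t} \<le> card ((dbl S a b - ?La) \<union> (dbl S c b - ?Lc))"
    by (intro card_mono) auto
  moreover have "\<dots> \<le> card (dbl S a b - ?La) + card (dbl S c b - ?Lc)"
    by (rule card_Un_le)
  moreover have "card (dbl S a b - ?La) \<le> 2"
    using universal_complete[OF S abc(1,2,4) v] .
  moreover have "card (dbl S c b - ?Lc) \<le> 2"
    using universal_complete[OF S abc(3,2) _ w'] abc by blast
  ultimately show False by linarith
qed

text \<open>Read \<open>U\<close> as a graph on the 5 points of \<open>S\<close>. By
  \<open>path\<close> no two edges share a point, so there are at most 2; choosing one end of each
  and a further unmatched point gives a triple without an edge, against \<open>tri\<close>.\<close>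

lemma no_co5: "\<not> co5 S"
proof
  assume S: "co5 S"
  define U where "U a b \<longleftrightarrow> (\<exists>v. universal S a b v)" for a b
  have U_sym: "U a b \<Longrightarrow> U b a" for a b
    using universal_commute by (auto simp: U_def)
  have path: "\<not> (U a b \<and> U b c)"
    if "a \<in> S" "b \<in> S" "c \<in> S" "a \<noteq> b" "a \<noteq> c" "b \<noteq> c" for a b c
    using universal_nonadjacent[OF S that] by (auto simp: U_def)
  have tri: "U a b \<or> U a c \<or> U b c"
    if "a \<in> S" "b \<in> S" "c \<in> S" "a \<noteq> b" "a \<noteq> c" "b \<noteq> c" for a b c
    using parity[OF S that] by (auto simp: U_def)
  obtain xs where xs: "set xs = S" "distinct xs"
    using finite_distinct_list[OF co5_finite[OF S]] by blast
  then have "length xs = Suc (Suc (Suc (Suc (Suc 0))))"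
    using S distinct_card[of xs] by (simp add: co5_def)
  then obtain a b c d e where "xs = [a, b, c, d, e]"
    by (auto simp: length_Suc_conv)
  then have S': "a \<in> S" "b \<in> S" "c \<in> S" "d \<in> S" "e \<in> S"
    and dist: "a \<noteq> b" "a \<noteq> c" "a \<noteq> d" "a \<noteq> e" "b \<noteq> c" "b \<noteq> d" "b \<noteq> e" "c \<noteq> d" "c \<noteq> e" "d \<noteq> e"
    using xs by auto
  show False
    using tri[of a b c] tri[of a b d] tri[of a b e] tri[of a c d] tri[of a c e] tri[of a d e]
      tri[of b c d] tri[of b c e] tri[of b d e] tri[of c d e] path S' dist U_sym by metis
qed

section \<open>Partition into four cliques\<close>

lemma ex_4_coclique: "\<exists>S. coclique S \<and> card S = 4"
proof -
  have "n \<le> 4 \<Longrightarrow> \<exists>S. coclique S \<and> card S = n" for n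
  proof (induction n)
    case 0
    have "coclique {}" by (simp add: coclique_def)
    then show ?case by (intro exI[of _ "{}"]) simp
  next
    case (Suc n)
    then obtain S where S: "coclique S" "card S = n" by (meson Suc_leD)
    moreover have "card S \<le> 3" using S Suc.prems by simp
    ultimately obtain z where z: "z \<in> V" "\<forall>s\<in>S. \<not> cl z s"
      using coclique_extend by blast
    then have "z \<notin> S" using cl_refl by blast
    moreover have "coclique (insert z S)"
      using z by (intro coclique_insert[OF S(1)]) auto
    ultimately show ?case
      using S coclique_finite[OF S(1)] by (intro exI[of _ "insert z S"]) simp
  qed
  then show ?thesis by simp
qed

text \<open>Replacing \<open>a\<close> by two nonadjacent private vertices would give a
  5-coclique.\<close>

lemma priv4_clique:
  assumes S: "coclique S" "card S = 4" "a \<in> S" and z: "z \<in> priv S a" and w: "w \<in> priv S a"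
  shows "cl z w"
proof (rule ccontr)
  assume zw: "\<not> cl z w"
  have nz: "\<not> cl z s" and nw: "\<not> cl w s" if "s \<in> S - {a}" for s
    using that privD[OF z] privD[OF w] by auto
  have "coclique (insert w (S - {a}))"
    using coclique_subset[OF S(1), of "S - {a}"] w nw
    by (intro coclique_insert) (auto simp: priv_def)
  then have "coclique (insert z (insert w (S - {a})))"
    by (rule coclique_insert) (use z zw nz in \<open>auto simp: priv_def\<close>)
  moreover have "z \<notin> insert w (S - {a})" "w \<notin> S - {a}"
    using nz nw zw cl_refl by blast+
  then have "card (insert z (insert w (S - {a}))) = 5"
    using S coclique_finite[OF S(1)] by simp
  ultimately show False using no_co5 by (auto simp: co5_def)
qed

text \<open>The other three members of \<open>S\<close> take at most 3 * 5 = 15 of the 26 vertices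
  in the closed neighbourhood of \<open>a\<close>.\<close>

lemma card_priv4:
  assumes S: "coclique S" "card S = 4" "a \<in> S"
  shows "card (priv S a) \<ge> 11"
proof -
  have aV: "a \<in> V" using S by (auto simp: coclique_def)
  have "{v \<in> V. cl v a} \<subseteq> priv S a \<union> (\<Union>b\<in>S - {a}. {v \<in> V. cl v a \<and> cl v b})"
    using S by (auto simp: priv_def)
  then have "26 \<le> card (priv S a \<union> (\<Union>b\<in>S - {a}. {v \<in> V. cl v a \<and> cl v b}))"
    using card_mono[of "priv S a \<union> (\<Union>b\<in>S - {a}. {v \<in> V. cl v a \<and> cl v b})" "{v \<in> V. cl v a}"]
      card_cl[OF aV] coclique_finite[OF S(1)] finite_V by simp
  also have "\<dots> \<le> card (priv S a) + card (\<Union>b\<in>S - {a}. {v \<in> V. cl v a \<and> cl v b})"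
    by (rule card_Un_le)
  also have "card (\<Union>b\<in>S - {a}. {v \<in> V. cl v a \<and> cl v b}) \<le> (\<Sum>b\<in>S - {a}. card {v \<in> V. cl v a \<and> cl v b})"
    using coclique_finite[OF S(1)] by (intro card_UN_le) simp
  also have "\<dots> \<le> (\<Sum>b\<in>S - {a}. 5)"
  proof (rule sum_mono)
    fix b assume "b \<in> S - {a}"
    then show "card {v \<in> V. cl v a \<and> cl v b} \<le> 5"
      using common_cl[OF S(1,3), of b] common_le[of a b] S aV by (auto simp: coclique_def subset_iff)
  qed
  also have "\<dots> = 15"
    using S coclique_finite[OF S(1)] by simp
  finally show ?thesis by simp
qed

text \<open>
  If \<open>v\<close> sees \<open>a \<in> S\<close> but misses \<open>z \<in> priv S a\<close>, exchange \<open>a\<close> for \<open>z\<close>: then \<open>v\<close> sees fewer members of the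
  coclique, and a private set loses at most 5 of its 11 vertices, so being joined to the remainder is
  enough.
\<close>

lemma absorbed:
  assumes "coclique S" "card S = 4" "v \<in> V"
  shows "\<exists>a\<in>S. v \<in> complete_to (priv S a)"
  using assms
proof (induction "card {s\<in>S. cl v s}" arbitrary: S rule: less_induct)
  case (less S)
  note S = less.prems(1,2)
  note finS = coclique_finite[OF S(1)]
  have "\<exists>a\<in>S. cl v a"
  proof (rule ccontr)
    assume *: "\<not> ?thesis"
    then have "coclique (insert v S)" "v \<notin> S"
      using coclique_insert[OF S(1) less.prems(3)] cl_refl by blast+
    then have "co5 (insert v S)"
      using S finS by (simp add: co5_def)
    then show False using no_co5 by blast
  qed
  then obtain a where a: "a \<in> S" "cl v a" by blast
  show ?case
  proof (cases "v \<in> complete_to (priv S a)")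
    case False
    then obtain z where z: "z \<in> priv S a" "\<not> cl z v"
      using less.prems(3) by (auto simp: complete_to_def)
    have zS: "\<not> cl z s" if "s \<in> S - {a}" for s
      using privD[OF z(1)] that by blast
    then have z_notin: "z \<notin> S - {a}" using cl_refl by blast
    define T where "T = insert z (S - {a})"
    have T: "coclique T" "card T = 4"
    proof -
      show "coclique T" unfolding T_def
        by (rule coclique_insert[OF coclique_subset[OF S(1)]]) (use z zS in \<open>auto simp: priv_def\<close>)
      show "card T = 4" using z_notin S finS a by (simp add: T_def)
    qed
    have "{s\<in>T. cl v s} \<subset> {s\<in>S. cl v s}"
      using a z by (auto simp: T_def cl_commute)
    then have "card {s\<in>T. cl v s} < card {s\<in>S. cl v s}"
      using finS by (intro psubset_card_mono) auto
    then obtain b where b: "b \<in> T" "v \<in> complete_to (priv T b)"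
      using less.hyps[OF _ T less.prems(3)] by blast
    have zT: "z \<in> priv T z"
    proof -
      have "\<forall>s\<in>T. cl z s \<longleftrightarrow> s = z" unfolding T_def using zS cl_refl by blast
      then show ?thesis using z by (simp add: priv_def)
    qed
    have "b \<noteq> z"
    proof
      assume "b = z"
      then have "cl z v" using b zT by (simp add: complete_to_def)
      then show False using z by simp
    qed
    then have bS: "b \<in> S" "b \<noteq> a" using b by (auto simp: T_def)
    have privT: "u \<in> priv T b" if "u \<in> priv S b" "\<not> cl u z" for u
    proof -
      have "cl u s \<longleftrightarrow> s = b" if "s \<in> T" for s
        using that privD[OF \<open>u \<in> priv S b\<close>] \<open>\<not> cl u z\<close> \<open>b \<noteq> z\<close> unfolding T_def by blast
      then show ?thesis using that by (simp add: priv_def)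
    qed
    have zb: "\<not> cl z b" "z \<in> V" "b \<in> V"
      using zS bS z S by (auto simp: priv_def coclique_def)
    have "v \<in> complete_to (priv S b)"
    proof (rule ccontr)
      assume "v \<notin> complete_to (priv S b)"
      then obtain q where q: "q \<in> priv S b" "\<not> cl q v"
        using less.prems(3) by (auto simp: complete_to_def)
      have vb: "v \<notin> priv S b" using privD[of v S b a] a bS by blast
      have qT: "q \<notin> priv T b" using q b by (auto simp: complete_to_def)
      \<comment> \<open>A vertex of \<open>priv S b\<close> seeing \<open>z\<close> is a common
        neighbour of \<open>z\<close> and \<open>b\<close>; any other one survives in
        \<open>priv T b\<close>, so it sees both \<open>v\<close> and \<open>q\<close>. Both pairs
        are nonadjacent, which bounds the set by 10, against the 11 of
        \<open>card_priv4\<close>.\<close>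
      have "priv S b \<subseteq> {u \<in> V. E u z \<and> E u b} \<union> {u \<in> V. E u q \<and> E u v}"
      proof
        fix u assume u: "u \<in> priv S b"
        have uV: "u \<in> V" and ub: "cl u b" using u bS by (auto simp: priv_def)
        show "u \<in> {u \<in> V. E u z \<and> E u b} \<union> {u \<in> V. E u q \<and> E u v}"
        proof (cases "cl u z")
          case True
          then have "u \<noteq> z" "u \<noteq> b" using ub zb cl_commute by blast+
          then show ?thesis using True ub uV by (simp add: cl_def)
        next
          case False
          then have uT: "u \<in> priv T b" using privT u by blast
          then have "cl u v" using b by (simp add: complete_to_def)
          moreover have "cl u q" using priv4_clique[OF S bS(1) u q(1)] .
          moreover have "u \<noteq> v" "u \<noteq> q" using u vb uT qT by auto
          ultimately show ?thesis using uV by (simp add: cl_def)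
        qed
      qed
      then have "card (priv S b) \<le> card ({u \<in> V. E u z \<and> E u b} \<union> {u \<in> V. E u q \<and> E u v})"
        using finite_V by (intro card_mono) auto
      also have "\<dots> \<le> card {u \<in> V. E u z \<and> E u b} + card {u \<in> V. E u q \<and> E u v}"
        by (rule card_Un_le)
      also have "card {u \<in> V. E u z \<and> E u b} \<le> 5"
        using zb by (intro common_le) (auto simp: cl_def)
      also have "card {u \<in> V. E u q \<and> E u v} \<le> 5"
        using q less.prems(3) by (intro common_le) (auto simp: cl_def priv_def)
      finally show False using card_priv4[OF S bS(1)] by simp
    qed
    then show ?thesis using bS by blast
  qed (use a in blast)
qed

section \<open>Covering by four cliques\<close>

definition clique :: "'a set \<Rightarrow> bool" where
  "clique K \<longleftrightarrow> K \<subseteq> V \<and> (\<forall>x\<in>K. \<forall>y\<in>K. cl x y)"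

text \<open>Two vertices outside \<open>priv S a\<close> share its at least 11 vertices as
  neighbours, too many for a nonadjacent pair.\<close>

lemma complete_to_clique:
  assumes "coclique S" "card S = 4" "a \<in> S"
  shows "clique (complete_to (priv S a))"
proof -
  have "cl u v" if uv: "u \<in> complete_to (priv S a)" "v \<in> complete_to (priv S a)" for u v
  proof (cases "u \<in> priv S a \<or> v \<in> priv S a")
    case True
    then show ?thesis using uv cl_commute by (auto simp: complete_to_def)
  next
    case False
    then show ?thesis
      using complete_adjacent[of "priv S a" u v] uv card_priv4[OF assms] by (auto simp: priv_def)
  qed
  then show ?thesis by (auto simp: clique_def complete_to_def)
qed

text \<open>The bound 20 is the clique bound 21 of the whole graph less the base vertex. Four
  cliques of at most 20 vertices cover 80, so all are full and pairwise disjoint.\<close>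

lemma clique_partition:
  assumes le20: "\<And>K. clique K \<Longrightarrow> card K \<le> 20"
  obtains S :: "'a set" and L where "finite S" "card S = 4" "(\<Union>a\<in>S. L a) = V"
    "\<And>a. a \<in> S \<Longrightarrow> clique (L a) \<and> card (L a) = 20"
    "\<And>a b. a \<in> S \<Longrightarrow> b \<in> S \<Longrightarrow> a \<noteq> b \<Longrightarrow> L a \<inter> L b = {}"
proof -
  obtain S where S: "coclique S" "card S = 4" using ex_4_coclique by blast
  note fin = coclique_finite[OF S(1)]
  define L where "L a = complete_to (priv S a)" for a
  have clL: "clique (L a)" if "a \<in> S" for a
    using complete_to_clique[OF S that] by (simp add: L_def)
  have L20: "card (L a) \<le> 20" if "a \<in> S" for a
    using clL le20 that by blast
  have finL: "finite (L a)" for a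
    using finite_V by (simp add: L_def complete_to_def)
  have cover: "(\<Union>a\<in>S. L a) = V"
    using absorbed[OF S] by (auto simp: L_def complete_to_def)
  have sum_le: "(\<Sum>a\<in>T. card (L a)) \<le> 20 * card T" if "T \<subseteq> S" for T
    using sum_bounded_above[of T "\<lambda>a. card (L a)" 20] L20 that by (simp add: subset_iff)
  have eq20: "card (L a) = 20" if a: "a \<in> S" for a
  proof -
    have "80 \<le> (\<Sum>a\<in>S. card (L a))"
      using card_UN_le[OF fin, of L] cover card_V by simp
    also have "\<dots> = card (L a) + (\<Sum>a\<in>S - {a}. card (L a))"
      using fin a by (rule sum.remove)
    finally show ?thesis
      using sum_le[of "S - {a}"] L20[OF a] S a fin by simp
  qed
  have "L a \<inter> L b = {}" if ab: "a \<in> S" "b \<in> S" "a \<noteq> b" for a b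
  proof -
    have "V = (L a \<union> L b) \<union> (\<Union>c\<in>S - {a, b}. L c)"
      using cover ab by blast
    then have "80 \<le> card (L a \<union> L b) + card (\<Union>c\<in>S - {a, b}. L c)"
      using card_Un_le[of "L a \<union> L b" "\<Union>c\<in>S - {a, b}. L c"] card_V by simp
    also have "card (\<Union>c\<in>S - {a, b}. L c) \<le> 20 * card (S - {a, b})"
      using card_UN_le[of "S - {a, b}" L] sum_le[of "S - {a, b}"] fin by simp
    also have "card (S - {a, b}) = 2"
      using ab S fin by (simp add: card_Diff_subset)
    finally have "40 \<le> card (L a \<union> L b)" by simp
    moreover have "card (L a) + card (L b) = card (L a \<union> L b) + card (L a \<inter> L b)"
      using finL by (intro card_Un_Int)
    ultimately have "card (L a \<inter> L b) = 0" using eq20 ab by simp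
    then show ?thesis using finL by simp
  qed
  then show thesis using that[of S L] fin S cover clL eq20 by blast
qed

text \<open>The bound 2 is the 3 of a 21-clique less the base vertex. A 20-clique other than the
  four of the partition would meet each of them in at most 2 vertices and so have at most 8.\<close>

lemma cliques20:
  assumes le20: "\<And>K. clique K \<Longrightarrow> card K \<le> 20"
    and nbrs2: "\<And>K u. clique K \<Longrightarrow> card K = 20 \<Longrightarrow> u \<in> V - K \<Longrightarrow> card {z \<in> K. E u z} \<le> 2"
  shows ex_clique20: "\<And>v. v \<in> V \<Longrightarrow> \<exists>K. clique K \<and> card K = 20 \<and> v \<in> K"
    and clique20_unique: "\<And>K K' v. clique K \<Longrightarrow> card K = 20 \<Longrightarrow> clique K' \<Longrightarrow> card K' = 20 \<Longrightarrow>
      v \<in> K \<Longrightarrow> v \<in> K' \<Longrightarrow> K = K'"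
proof -
  obtain S :: "'a set" and L where S: "finite S" "card S = 4" and cover: "(\<Union>a\<in>S. L a) = V"
    and L: "\<And>a. a \<in> S \<Longrightarrow> clique (L a) \<and> card (L a) = 20"
    and disj: "\<And>a b. a \<in> S \<Longrightarrow> b \<in> S \<Longrightarrow> a \<noteq> b \<Longrightarrow> L a \<inter> L b = {}"
    using clique_partition[OF le20] by blast
  show "\<exists>K. clique K \<and> card K = 20 \<and> v \<in> K" if "v \<in> V" for v
    using that cover L by blast
  have is_L: "\<exists>a\<in>S. K = L a" if K: "clique K" "card K = 20" for K
  proof (rule ccontr)
    assume neg: "\<not> ?thesis"
    have KV: "K \<subseteq> V" using K by (simp add: clique_def)
    have "card (K \<inter> L a) \<le> 2" if a: "a \<in> S" for a
    proof -
      have "finite (L a)" using L[OF a] card.infinite by fastforce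
      then have "\<not> K \<subseteq> L a" using card_subset_eq[of "L a" K] L[OF a] K neg a by auto
      then obtain u where u: "u \<in> K" "u \<notin> L a" by blast
      have "K \<inter> L a \<subseteq> {z \<in> L a. E u z}"
        using u K by (auto simp: clique_def cl_def)
      then have "card (K \<inter> L a) \<le> card {z \<in> L a. E u z}"
        using \<open>finite (L a)\<close> by (intro card_mono) auto
      also have "\<dots> \<le> 2" using nbrs2[of "L a" u] L[OF a] u KV by blast
      finally show ?thesis .
    qed
    then have "(\<Sum>a\<in>S. card (K \<inter> L a)) \<le> 8"
      using sum_bounded_above[of S "\<lambda>a. card (K \<inter> L a)" 2] S by simp
    moreover have "K = (\<Union>a\<in>S. K \<inter> L a)" using cover KV by blast
    then have "card K \<le> (\<Sum>a\<in>S. card (K \<inter> L a))"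
      using card_UN_le[OF S(1), of "\<lambda>a. K \<inter> L a"] by simp
    ultimately show False using K by simp
  qed
  show "K = K'" if "clique K" "card K = 20" "clique K'" "card K' = 20" "v \<in> K" "v \<in> K'" for K K' v
    using is_L[of K] is_L[of K'] disj that by blast
qed

end

section \<open>Delsarte cliques\<close>

text \<open>Distance-regularity with a natural-number distance. The form
  \<open>d x z + 1 = d x y\<close> avoids truncated subtraction: at distance 0 the set is empty, in
  accordance with \<open>c 0 = 0\<close>.\<close>

locale drg_80_54_12 =
  fixes V :: "'a set" and E :: "'a \<Rightarrow> 'a \<Rightarrow> bool" and d :: "'a \<Rightarrow> 'a \<Rightarrow> nat"
    and b c :: "nat \<Rightarrow> nat"
  assumes finite_V: "finite V" and nonempty: "V \<noteq> {}"
    and E_V: "E x y \<Longrightarrow> x \<in> V \<and> y \<in> V"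
    and E_sym: "E x y \<Longrightarrow> E y x"
    and d_le: "x \<in> V \<Longrightarrow> y \<in> V \<Longrightarrow> d x y \<le> 3"
    and d_0: "x \<in> V \<Longrightarrow> y \<in> V \<Longrightarrow> d x y = 0 \<longleftrightarrow> x = y"
    and d_1: "x \<in> V \<Longrightarrow> y \<in> V \<Longrightarrow> d x y = 1 \<longleftrightarrow> E x y"
    and d_sym: "x \<in> V \<Longrightarrow> y \<in> V \<Longrightarrow> d x y = d y x"
    and d_step: "x \<in> V \<Longrightarrow> E y z \<Longrightarrow> d x z \<le> d x y + 1"
    and card_c: "x \<in> V \<Longrightarrow> y \<in> V \<Longrightarrow> card {z. E y z \<and> d x z + 1 = d x y} = c (d x y)"
    and card_b: "x \<in> V \<Longrightarrow> y \<in> V \<Longrightarrow> card {z. E y z \<and> d x z = d x y + 1} = b (d x y)"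
    and b_eq: "b 0 = 80" "b (Suc 0) = 54" "b 2 = 12" "b 3 = 0"
    and c_eq: "c 0 = 0" "c (Suc 0) = 1" "c 2 = 6" "c 3 = 60"
begin

section \<open>Neighbour counts by distance and the eigenvalue -4\<close>

definition nb :: "'a \<Rightarrow> 'a set" where
  "nb y = {z. E y z}"

text \<open>The intersection numbers usually written \<open>a i\<close>; their values are 0, 25, 62,
  20.\<close>

definition stay :: "nat \<Rightarrow> nat" where
  "stay i = 80 - b i - c i"

lemma E_irrefl: "\<not> E x x"
  using E_V[of x x] d_0[of x x] d_1[of x x] by auto

lemma finite_nb [simp]: "finite (nb y)"
  using finite_V E_V by (auto simp: nb_def intro: finite_subset[of _ V])

lemma d_cases:
  assumes "x \<in> V" "y \<in> V"
  obtains "d x y = 0" | "d x y = 1" | "d x y = 2" | "d x y = 3"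
  using d_le[OF assms] by linarith

lemma card_nb: "y \<in> V \<Longrightarrow> card (nb y) = 80"
proof -
  assume y: "y \<in> V"
  have "nb y = {z. E y z \<and> d y z = d y y + 1}"
    using y E_V d_0[of y y] d_1[of y] by (auto simp: nb_def)
  then show ?thesis using card_b[OF y y] d_0[OF y y] b_eq by simp
qed

text \<open>The tridiagonal action of the adjacency matrix on functions of the distance to
  \<open>x\<close>. For \<open>y = x\<close> the truncated \<open>d x y - 1\<close> carries the
  factor \<open>c 0 = 0\<close>.\<close>

lemma nb_split:
  assumes "x \<in> V" "y \<in> V"
  shows "card {z. E y z \<and> d x z = d x y} = stay (d x y)"
    and "(\<Sum>z\<in>nb y. \<phi> (d x z)) = int (c (d x y)) * \<phi> (d x y - 1)
      + int (stay (d x y)) * \<phi> (d x y) + int (b (d x y)) * \<phi> (d x y + 1)"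
proof -
  define A where "A = {z. E y z \<and> d x z = d x y}"
  define B where "B = {z. E y z \<and> d x z = d x y + 1}"
  define C where "C = {z. E y z \<and> d x z + 1 = d x y}"
  have un: "nb y = C \<union> (A \<union> B)"
  proof (intro subset_antisym subsetI)
    fix z assume "z \<in> nb y"
    then have "E y z" by (simp add: nb_def)
    then have "d x z \<le> d x y + 1" "d x y \<le> d x z + 1"
      using d_step[OF assms(1)] E_sym by blast+
    then show "z \<in> C \<union> (A \<union> B)"
      using \<open>E y z\<close> by (auto simp: A_def B_def C_def)
  qed (auto simp: A_def B_def C_def nb_def)
  have fin: "finite A" "finite B" "finite C"
    using finite_nb[of y] by (auto simp: un)
  have disj: "A \<inter> B = {}" "C \<inter> (A \<union> B) = {}"
    by (auto simp: A_def B_def C_def)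
  have cB: "card B = b (d x y)" and cC: "card C = c (d x y)"
    using card_b[OF assms] card_c[OF assms] by (simp_all add: B_def C_def)
  have "80 = card C + (card A + card B)"
    using card_nb[OF assms(2)] fin disj by (simp add: un card_Un_disjoint)
  then have cA: "card A = stay (d x y)"
    using cB cC by (simp add: stay_def)
  then show "card {z. E y z \<and> d x z = d x y} = stay (d x y)" by (simp add: A_def)
  have "(\<Sum>z\<in>nb y. \<phi> (d x z)) = (\<Sum>z\<in>C. \<phi> (d x z)) + ((\<Sum>z\<in>A. \<phi> (d x z)) + (\<Sum>z\<in>B. \<phi> (d x z)))"
    unfolding un using fin disj by (simp add: sum.union_disjoint)
  also have "(\<Sum>z\<in>C. \<phi> (d x z)) = (\<Sum>z\<in>C. \<phi> (d x y - 1))"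
  proof (intro sum.cong refl)
    fix z assume "z \<in> C"
    then have "d x z = d x y - 1" by (auto simp: C_def)
    then show "\<phi> (d x z) = \<phi> (d x y - 1)" by simp
  qed
  also have "(\<Sum>z\<in>A. \<phi> (d x z)) = (\<Sum>z\<in>A. \<phi> (d x y))"
    by (intro sum.cong) (auto simp: A_def)
  also have "(\<Sum>z\<in>B. \<phi> (d x z)) = (\<Sum>z\<in>B. \<phi> (d x y + 1))"
    by (intro sum.cong) (auto simp: B_def)
  finally show "(\<Sum>z\<in>nb y. \<phi> (d x z)) = int (c (d x y)) * \<phi> (d x y - 1)
      + int (stay (d x y)) * \<phi> (d x y) + int (b (d x y)) * \<phi> (d x y + 1)"
    by (simp add: cA cB cC)
qed

text \<open>The standard sequence of the eigenvalue \<open>-4\<close>, scaled by 240 to be integral.\<close>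

definition f :: "nat \<Rightarrow> int" where
  "f i = (if i = 0 then 240 else if i = 1 then -12 else if i = 2 then 2 else -5)"

lemma f_eigen:
  assumes "x \<in> V" "y \<in> V"
  shows "(\<Sum>z\<in>nb y. f (d x z)) = - 4 * f (d x y)"
  unfolding nb_split(2)[OF assms, of f]
  by (cases rule: d_cases[OF assms]) (simp_all add: stay_def b_eq c_eq f_def)

text \<open>Symmetry of the adjacency matrix.\<close>

lemma sum_nb_swap:
  fixes g :: "'a \<Rightarrow> int"
  shows "(\<Sum>z\<in>V. h z * (\<Sum>w\<in>nb z. g w)) = (\<Sum>w\<in>V. g w * (\<Sum>z\<in>nb w. h z))"
proof -
  have nb_sum: "(\<Sum>w\<in>nb z. k w) = (\<Sum>w\<in>V. if E z w then k w else 0)" if "z \<in> V" for z and k :: "'a \<Rightarrow> int"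
  proof -
    have "nb z = {w \<in> V. E z w}" using E_V by (auto simp: nb_def)
    then show ?thesis using finite_V by (simp add: sum.inter_filter)
  qed
  have "(\<Sum>z\<in>V. h z * (\<Sum>w\<in>nb z. g w)) = (\<Sum>z\<in>V. \<Sum>w\<in>V. if E z w then h z * g w else 0)"
    by (intro sum.cong refl) (simp add: nb_sum sum_distrib_left if_distrib cong: if_cong)
  also have "\<dots> = (\<Sum>w\<in>V. \<Sum>z\<in>V. if E z w then h z * g w else 0)"
    by (rule sum.swap)
  also have "\<dots> = (\<Sum>w\<in>V. \<Sum>z\<in>V. if E w z then h z * g w else 0)"
    using E_sym by (intro sum.cong refl) meson
  also have "\<dots> = (\<Sum>w\<in>V. g w * (\<Sum>z\<in>nb w. h z))"
    by (intro sum.cong refl) (simp add: nb_sum sum_distrib_left if_distrib mult.commute cong: if_cong)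
  finally show ?thesis .
qed

text \<open>The matrix with entries \<open>f (d x z)\<close> acts as 315 on the eigenspace of -4; it
  is a scaled primitive idempotent. The sums \<open>S i\<close> of \<open>g\<close> over the spheres
  around \<open>x\<close> obey a three-term recurrence, so \<open>g x\<close> determines
  them.\<close>

lemma eigen_sum:
  fixes g :: "'a \<Rightarrow> int"
  assumes x: "x \<in> V" and g: "\<And>z. z \<in> V \<Longrightarrow> (\<Sum>w\<in>nb z. g w) = - 4 * g z"
  shows "(\<Sum>z\<in>V. f (d x z) * g z) = 315 * g x"
proof -
  define S where "S i = (\<Sum>z\<in>V. if d x z = i then g z else 0)" for i
  have *: "- 4 * S i = (\<Sum>w\<in>V. g w * (\<Sum>z\<in>nb w. if d x z = i then 1 else 0))" for i
  proof -
    have "- 4 * S i = (\<Sum>z\<in>V. (if d x z = i then 1 else 0) * (\<Sum>w\<in>nb z. g w))"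
      unfolding S_def sum_distrib_left by (intro sum.cong refl) (simp add: g)
    then show ?thesis by (simp only: sum_nb_swap)
  qed
  have S0: "S 0 = g x"
  proof -
    have "S 0 = (\<Sum>z\<in>V. if z = x then g z else 0)"
      unfolding S_def using d_0[OF x] by (intro sum.cong refl) auto
    then show ?thesis using x finite_V by simp
  qed
  have lin: "(\<Sum>w\<in>V. g w * \<phi> (d x w)) = \<phi> 0 * S 0 + \<phi> 1 * S 1 + \<phi> 2 * S 2 + \<phi> 3 * S 3" for \<phi>
    unfolding S_def sum_distrib_left sum.distrib[symmetric]
  proof (intro sum.cong refl)
    fix w assume w: "w \<in> V"
    show "g w * \<phi> (d x w) = \<phi> 0 * (if d x w = 0 then g w else 0) + \<phi> 1 * (if d x w = 1 then g w else 0)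
      + \<phi> 2 * (if d x w = 2 then g w else 0) + \<phi> 3 * (if d x w = 3 then g w else 0)"
      by (cases rule: d_cases[OF x w]) simp_all
  qed
  \<comment> \<open>For \<open>j\<close> up to 3, the number of neighbours at distance
    \<open>i\<close> from \<open>x\<close> of a vertex at distance \<open>j\<close> from
    \<open>x\<close>.\<close>
  define \<psi> where "\<psi> i j = int (c j) * (if j - 1 = i then 1 else 0) + int (stay j) * (if j = i then 1 else 0)
    + int (b j) * (if j + 1 = i then 1 else 0)" for i j :: nat
  have rec: "- 4 * S i = \<psi> i 0 * S 0 + \<psi> i 1 * S 1 + \<psi> i 2 * S 2 + \<psi> i 3 * S 3" for i
    unfolding * lin[symmetric]
  proof (intro sum.cong refl)
    fix w assume "w \<in> V"
    then show "g w * (\<Sum>z\<in>nb w. if d x z = i then 1 else 0) = g w * \<psi> i (d x w)"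
      by (simp only: nb_split(2)[OF x, of w "\<lambda>j. if j = i then 1 else 0"] \<psi>_def)
  qed
  \<comment> \<open>Solving gives \<open>S 1 = - 4 * S 0\<close>, \<open>S 2 = 6 * S 0\<close>,
    \<open>S 3 = - 3 * S 0\<close>, and 240 + 48 + 12 + 15 = 315.\<close>
  have "- 4 * S 0 = S 1" "- 4 * S 1 = 80 * S 0 + 25 * S 1 + 6 * S 2"
    "- 4 * S 2 = 54 * S 1 + 62 * S 2 + 60 * S 3"
    unfolding rec by (simp_all add: \<psi>_def stay_def b_eq c_eq)
  moreover have "(\<Sum>z\<in>V. f (d x z) * g z) = 240 * S 0 - 12 * S 1 + 2 * S 2 - 5 * S 3"
    using lin[of f] by (simp add: f_def mult.commute)
  ultimately show ?thesis using S0 by simp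
qed

section \<open>The clique bound and its equality case\<close>

definition gclique :: "'a set \<Rightarrow> bool" where
  "gclique K \<longleftrightarrow> K \<subseteq> V \<and> (\<forall>x\<in>K. \<forall>y\<in>K. x \<noteq> y \<longrightarrow> E x y)"

lemma gcliqueD: "gclique K \<Longrightarrow> x \<in> K \<Longrightarrow> y \<in> K \<Longrightarrow> x \<noteq> y \<Longrightarrow> E x y"
  by (simp add: gclique_def)

lemma clique_finite: "gclique K \<Longrightarrow> finite K"
  using finite_V finite_subset by (auto simp: gclique_def)

text \<open>By \<open>eigen_sum\<close> the inner product of the functions belonging to
  \<open>x\<close> and \<open>y\<close> is \<open>315 * f (d y x)\<close>, that is, 315 times 240 or
  -12; summing over \<open>K\<close> for fixed \<open>x\<close> gives
  \<open>315 * (252 - 12 * card K)\<close>.\<close>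

lemma clique_squares:
  assumes K: "gclique K"
  shows "(\<Sum>z\<in>V. (\<Sum>x\<in>K. f (d x z))\<^sup>2) = 315 * 12 * int (card K) * (21 - int (card K))"
proof -
  have KV: "K \<subseteq> V" using K by (simp add: gclique_def)
  note fin = clique_finite[OF K]
  have "(\<Sum>z\<in>V. (\<Sum>x\<in>K. f (d x z))\<^sup>2) = (\<Sum>z\<in>V. \<Sum>x\<in>K. \<Sum>y\<in>K. f (d x z) * f (d y z))"
    by (simp add: power2_eq_square sum_product)
  also have "\<dots> = (\<Sum>x\<in>K. \<Sum>z\<in>V. \<Sum>y\<in>K. f (d x z) * f (d y z))"
    by (rule sum.swap)
  also have "\<dots> = (\<Sum>x\<in>K. \<Sum>y\<in>K. \<Sum>z\<in>V. f (d x z) * f (d y z))"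
    by (rule sum.cong[OF refl]) (rule sum.swap)
  also have "\<dots> = (\<Sum>x\<in>K. \<Sum>y\<in>K. 315 * (if y = x then 240 else - 12))"
  proof (intro sum.cong refl)
    fix x y assume xy: "x \<in> K" "y \<in> K"
    then have V: "x \<in> V" "y \<in> V" using KV by auto
    have "(\<Sum>z\<in>V. f (d x z) * f (d y z)) = 315 * f (d y x)"
      using eigen_sum[OF V(1), of "\<lambda>z. f (d y z)"] f_eigen[OF V(2)] by blast
    also have "f (d y x) = (if y = x then 240 else - 12)"
      using d_0[OF V(2,1)] d_1[OF V(2,1)] K xy by (auto simp: f_def gclique_def)
    finally show "(\<Sum>z\<in>V. f (d x z) * f (d y z)) = 315 * (if y = x then 240 else - 12)" .
  qed
  also have "\<dots> = (\<Sum>x\<in>K. 315 * (252 - 12 * int (card K)))"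
  proof (intro sum.cong refl)
    fix x assume x: "x \<in> K"
    have "(\<Sum>y\<in>K. 315 * (if y = x then 240 else - 12)) = (\<Sum>y\<in>K. (if y = x then 315 * 252 else 0) - 315 * 12 :: int)"
      by (intro sum.cong) auto
    also have "\<dots> = 315 * (252 - 12 * int (card K))"
      using fin x by (simp add: sum_subtractf)
    finally show "(\<Sum>y\<in>K. 315 * (if y = x then 240 else - 12)) = 315 * (252 - 12 * int (card K))" .
  qed
  also have "\<dots> = 315 * 12 * int (card K) * (21 - int (card K))"
    by (simp add: algebra_simps)
  finally show ?thesis .
qed

text \<open>A sum of squares is nonnegative. This is the Delsarte bound 1 + 80/4.\<close>

lemma clique_le:
  assumes "gclique K"
  shows "card K \<le> 21"
proof (rule ccontr)
  assume *: "\<not> card K \<le> 21"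
  have "0 \<le> 315 * 12 * int (card K) * (21 - int (card K))"
    unfolding clique_squares[OF assms, symmetric] by (intro sum_nonneg) simp
  then show False using * by (simp add: zero_le_mult_iff)
qed

text \<open>Equality in the bound makes every square vanish. All of \<open>K\<close> is within
  distance 2 of \<open>u\<close>, so \<open>n\<close> neighbours of \<open>u\<close> in
  \<open>K\<close> satisfy -12 n + 2 (21 - n) = 0.\<close>

lemma clique_nbrs:
  assumes K: "gclique K" "card K = 21" and u: "u \<notin> K" "x \<in> K" "E u x"
  shows "card {y \<in> K. E u y} = 3"
proof -
  have uV: "u \<in> V" and KV: "K \<subseteq> V" using u E_V K by (auto simp: gclique_def)
  note fin = clique_finite[OF K(1)]
  have "(\<Sum>z\<in>V. (\<Sum>x\<in>K. f (d x z))\<^sup>2) = 0"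
    using clique_squares[OF K(1)] K(2) by simp
  then have "(\<Sum>x\<in>K. f (d x u)) = 0"
    using finite_V uV by (subst (asm) sum_nonneg_eq_0_iff) auto
  moreover have "f (d y u) = (if E u y then - 14 else 0) + 2" if y: "y \<in> K" for y
  proof -
    have yV: "y \<in> V" "x \<in> V" using y u KV by auto
    have "d u y \<le> d u x + 1 \<or> y = x"
      using d_step[OF uV, of x y] K(1) y u by (auto simp: gclique_def)
    moreover have "d u x = 1" "d u y \<noteq> 0" "d u y = d y u"
      using d_1[OF uV yV(2)] d_0[OF uV yV(1)] d_sym[OF uV yV(1)] u y by auto
    ultimately show ?thesis
      using d_1[OF uV yV(1)] by (auto simp: f_def)
  qed
  ultimately have "(\<Sum>y\<in>K. (if E u y then - 14 else 0) + 2) = (0::int)" by simp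
  then have "- 14 * int (card {y \<in> K. E u y}) + 42 = 0"
    using fin K(2) by (simp add: sum.distrib flip: sum.inter_filter)
  then show ?thesis by simp
qed

section \<open>Local graphs and lines\<close>

lemma common_adj:
  assumes "E x y"
  shows "card {z. E x z \<and> E y z} = 25"
proof -
  have V: "x \<in> V" "y \<in> V" and "d x y = 1" using assms E_V d_1 by blast+
  moreover have "{z. E x z \<and> E y z} = {z. E y z \<and> d x z = 1}"
    using V d_1 E_V by blast
  ultimately show ?thesis
    using nb_split(1)[OF V] by (simp add: stay_def b_eq c_eq)
qed

lemma common_nonadj:
  assumes "x \<noteq> y" "\<not> E x y" "E x z" "E y z"
  shows "d x y = 2" and "card {z. E x z \<and> E y z} = 6"
proof -
  have V: "x \<in> V" "y \<in> V" "z \<in> V" using assms E_V by blast+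
  have "d x z = 1" using V d_1 assms by blast
  then have "d x y \<le> 2" using d_step[OF V(1) E_sym[OF assms(4)]] by simp
  then show 2: "d x y = 2"
    using d_0[OF V(1,2)] d_1[OF V(1,2)] assms by linarith
  have "{z. E x z \<and> E y z} = {z. E y z \<and> d x z + 1 = d x y}"
    using V d_1 E_V 2 by auto
  then show "card {z. E x z \<and> E y z} = 6"
    using card_c[OF V(1,2)] 2 c_eq by simp
qed

lemma local_graph_nb:
  assumes x: "x \<in> V"
  shows "local_graph (nb x) E"
proof
  show "card (nb x) = 80" using card_nb[OF x] .
  show "card {z \<in> nb x. E y z} = 25" if "y \<in> nb x" for y
    using common_adj[of x y] that by (simp add: nb_def)
  show "card {z \<in> nb x. E z u \<and> E z v} \<le> 5" if "u \<in> nb x" "v \<in> nb x" "u \<noteq> v" "\<not> E u v" for u v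
  proof -
    have xE: "E u x" "E v x" using that E_sym by (auto simp: nb_def)
    \<comment> \<open>\<open>x\<close> is one of the 6 common neighbours of \<open>u\<close> and
      \<open>v\<close>, which leaves at most 5 in \<open>nb x\<close>.\<close>
    have sub: "insert x {z \<in> nb x. E z u \<and> E z v} \<subseteq> {z. E u z \<and> E v z}"
      using xE E_sym by (auto simp: nb_def)
    have "finite {z. E u z \<and> E v z}"
      using finite_nb[of u] by (rule finite_subset[rotated]) (auto simp: nb_def)
    then have "card (insert x {z \<in> nb x. E z u \<and> E z v}) \<le> 6"
      using card_mono[OF _ sub] common_nonadj(2)[OF that(3,4) xE] by simp
    moreover have "x \<notin> {z \<in> nb x. E z u \<and> E z v}" using E_irrefl by (simp add: nb_def)
    ultimately show ?thesis by simp
  qed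
qed (use E_sym E_irrefl in auto)

lemma local_clique:
  assumes "x \<in> V" "local_graph.clique (nb x) E K"
  shows "gclique (insert x K)" "x \<notin> K"
proof -
  interpret L: local_graph "nb x" E using local_graph_nb[OF assms(1)] .
  have "K \<subseteq> nb x" "\<forall>y\<in>K. \<forall>z\<in>K. y = z \<or> E y z"
    using assms(2) by (auto simp: L.clique_def L.cl_def)
  then show "gclique (insert x K)" "x \<notin> K"
    using assms(1) E_V E_sym E_irrefl unfolding gclique_def nb_def by blast+
qed

lemma local_clique_remove:
  assumes "gclique K" "x \<in> K"
  shows "local_graph.clique (nb x) E (K - {x})"
proof -
  have "x \<in> V" using assms by (auto simp: gclique_def)
  interpret L: local_graph "nb x" E using local_graph_nb[OF \<open>x \<in> V\<close>] .
  have "K - {x} \<subseteq> nb x" "\<forall>y\<in>K. \<forall>z\<in>K. y = z \<or> E y z"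
    using assms by (auto simp: gclique_def nb_def)
  then show ?thesis
    unfolding L.clique_def L.cl_def by blast
qed

lemma local_le20:
  assumes "x \<in> V" "local_graph.clique (nb x) E K"
  shows "card K \<le> 20"
proof (cases "finite K")
  case True
  then show ?thesis
    using clique_le[OF local_clique(1)[OF assms]] local_clique(2)[OF assms] by simp
qed simp

lemma local_nbrs2:
  assumes x: "x \<in> V" and K: "local_graph.clique (nb x) E K" "card K = 20" and u: "u \<in> nb x - K"
  shows "card {z \<in> K. E u z} \<le> 2"
proof -
  note K' = local_clique[OF x K(1)]
  have fin: "finite K" using K(2) card.infinite by fastforce
  have ux: "E u x" "u \<noteq> x" using u E_sym E_irrefl by (auto simp: nb_def)
  then have "{y \<in> insert x K. E u y} = insert x {z \<in> K. E u z}" by auto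
  then show ?thesis
    using clique_nbrs[OF K'(1), of u x] K' K(2) u ux fin by simp
qed

text \<open>Adding \<open>x\<close> to the 20-clique through \<open>y\<close> in the local graph at
  \<open>x\<close> gives the line joining them.\<close>

lemma ex_line:
  assumes "E x y"
  shows "\<exists>K. gclique K \<and> card K = 21 \<and> x \<in> K \<and> y \<in> K"
proof -
  have x: "x \<in> V" using assms E_V by blast
  interpret L: local_graph "nb x" E using local_graph_nb[OF x] .
  have "y \<in> nb x" using assms by (simp add: nb_def)
  then obtain K where K: "L.clique K" "card K = 20" "y \<in> K"
    using L.ex_clique20[OF local_le20[OF x] local_nbrs2[OF x]] by blast
  then have "finite K" using card.infinite by fastforce
  then show ?thesis
    using local_clique[OF x K(1)] K by (intro exI[of _ "insert x K"]) simp
qed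

text \<open>Removing \<open>x\<close> leaves 20-cliques of the local graph at \<open>x\<close> that
  share \<open>y\<close>.\<close>

lemma line_unique:
  assumes "gclique K" "card K = 21" "gclique K'" "card K' = 21"
    and "x \<in> K" "x \<in> K'" "y \<in> K" "y \<in> K'" "x \<noteq> y"
  shows "K = K'"
proof -
  have x: "x \<in> V" using assms by (auto simp: gclique_def)
  interpret L: local_graph "nb x" E using local_graph_nb[OF x] .
  have c: "card (K - {x}) = 20" "card (K' - {x}) = 20"
    using assms(2,4,5,6) by (simp_all add: card_Diff_singleton)
  have y: "y \<in> K - {x}" "y \<in> K' - {x}" using assms by blast+
  have "K - {x} = K' - {x}"
    by (rule L.clique20_unique[OF local_le20[OF x] local_nbrs2[OF x]
        local_clique_remove[OF assms(1,5)] c(1) local_clique_remove[OF assms(3,6)] c(2) y])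
  then show ?thesis using assms by blast
qed

section \<open>Double counting against a line\<close>

lemma contradiction: False
proof -
  obtain x0 where "x0 \<in> V" using nonempty by blast
  then have "nb x0 \<noteq> {}" using card_nb[of x0] by auto
  then obtain y0 where "E x0 y0" by (auto simp: nb_def)
  then obtain C where C: "gclique C" "card C = 21" "x0 \<in> C" using ex_line by blast
  note finC = clique_finite[OF C(1)]
  have "\<not> nb x0 \<subseteq> C"
    using card_mono[OF finC, of "nb x0"] card_nb[OF \<open>x0 \<in> V\<close>] C(2) by auto
  then obtain v where v: "E x0 v" "v \<notin> C" by (auto simp: nb_def)
  define T where "T = {y \<in> C. E v y}"
  have T: "card T = 3" "T \<subseteq> C" "finite T"
    using clique_nbrs[OF C(1,2) v(2) C(3) E_sym[OF v(1)]] finC by (auto simp: T_def)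
  have "\<forall>y\<in>T. \<exists>K. gclique K \<and> card K = 21 \<and> v \<in> K \<and> y \<in> K"
    using ex_line by (auto simp: T_def)
  then obtain L where L: "\<And>y. y \<in> T \<Longrightarrow> gclique (L y)" "\<And>y. y \<in> T \<Longrightarrow> card (L y) = 21"
    "\<And>y. y \<in> T \<Longrightarrow> v \<in> L y" "\<And>y. y \<in> T \<Longrightarrow> y \<in> L y" by metis
  \<comment> \<open>A second common point would force \<open>L y = C\<close>, but \<open>v\<close>
    is on \<open>L y\<close> and not on \<open>C\<close>.\<close>
  have LC: "u = y" if "y \<in> T" "u \<in> L y" "u \<in> C" for u y
    using line_unique[OF C(1,2) L(1,2)[OF that(1)], of u y] L(3,4)[OF that(1)] that T v by blast
  \<comment> \<open>Two of these lines with a second common point would coincide and then meet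
    \<open>C\<close> twice.\<close>
  have LL: "u = v" if "y \<in> T" "z \<in> T" "y \<noteq> z" "u \<in> L y" "u \<in> L z" for u y z
  proof (rule ccontr)
    assume "u \<noteq> v"
    then have "L y = L z"
      using line_unique[OF L(1,2)[OF that(1)] L(1,2)[OF that(2)], of u v] L(3) that by blast
    then have "z \<in> L y" using L(4)[OF that(2)] by simp
    then show False using LC[OF that(1), of z] that T by blast
  qed
  \<comment> \<open>The 21 - 2 = 19 further points on each of the three lines, 57 in all.\<close>
  define W where "W = (\<Union>y\<in>T. L y - {v, y})"
  have finL: "finite (L y)" if "y \<in> T" for y using clique_finite L that by blast
  then have finW: "finite W" using T by (simp add: W_def)
  have "card W = (\<Sum>y\<in>T. card (L y - {v, y}))"
    unfolding W_def
  proof (rule card_UN_disjoint)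
    show "\<forall>i\<in>T. \<forall>j\<in>T. i \<noteq> j \<longrightarrow> (L i - {v, i}) \<inter> (L j - {v, j}) = {}"
      using LL by blast
  qed (use T finL in auto)
  also have "\<dots> = (\<Sum>y\<in>T. 19)"
  proof (rule sum.cong[OF refl])
    fix y assume y: "y \<in> T"
    then have "y \<noteq> v" using T v by blast
    then show "card (L y - {v, y}) = 19"
      using L[OF y] finL[OF y] by (simp add: card_Diff_subset)
  qed
  finally have cardW: "card W = 57" using T by simp
  have Wv: "W \<subseteq> nb v - T"
  proof
    fix w assume "w \<in> W"
    then obtain y where y: "y \<in> T" "w \<in> L y" "w \<noteq> v" "w \<noteq> y" unfolding W_def by blast
    have "E v w" using gcliqueD[OF L(1,3)[OF y(1)] y(2)] y(3) by simp
    moreover have "w \<notin> T" using LC[OF y(1,2)] y T by blast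
    ultimately show "w \<in> nb v - T" by (simp add: nb_def)
  qed
  have W3: "card {y \<in> C. E w y} = 3" if w: "w \<in> W" for w
  proof -
    obtain y where y: "y \<in> T" "w \<in> L y" "w \<noteq> y" using w unfolding W_def by blast
    then have "w \<notin> C" "y \<in> C" using LC T by blast+
    moreover have "E w y" using gcliqueD[OF L(1)[OF y(1)] y(2) L(4)[OF y(1)] y(3)] .
    ultimately show ?thesis using clique_nbrs[OF C(1,2)] by blast
  qed
  have T20: "card {y \<in> C. E t y} = 20" if "t \<in> T" for t
  proof -
    have "{y \<in> C. E t y} = C - {t}"
      using C(1) T that E_irrefl by (auto simp: gclique_def)
    then show ?thesis using C(2) T that finC by auto
  qed
  have "231 = (\<Sum>w\<in>T. 20) + (\<Sum>w\<in>W. 3::nat)"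
    using T cardW by simp
  also have "\<dots> = (\<Sum>w\<in>T. card {y \<in> C. E w y}) + (\<Sum>w\<in>W. card {y \<in> C. E w y})"
    using T20 W3 by simp
  also have "\<dots> = (\<Sum>w\<in>T \<union> W. card {y \<in> C. E w y})"
    using T finW Wv by (subst sum.union_disjoint) auto
  also have "\<dots> \<le> (\<Sum>w\<in>nb v. card {y \<in> C. E w y})"
  proof (rule sum_mono2)
    show "T \<union> W \<subseteq> nb v" using Wv by (auto simp: T_def nb_def)
  qed simp_all
  also have "\<dots> = (\<Sum>y\<in>C. card {w \<in> nb v. E w y})"
    by (rule sum_card_swap) (simp_all add: finC)
  also have "\<dots> = (\<Sum>y\<in>C. (if y \<in> T then 25 else 6))"
  proof (rule sum.cong[OF refl])
    fix y assume y: "y \<in> C"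
    have eq: "{w \<in> nb v. E w y} = {w. E v w \<and> E y w}"
      using E_sym by (auto simp: nb_def)
    show "card {w \<in> nb v. E w y} = (if y \<in> T then 25 else 6)"
    proof (cases "y \<in> T")
      case True
      then show ?thesis using common_adj[of v y] eq by (simp add: T_def)
    next
      case False
      \<comment> \<open>\<open>x0\<close> is a common neighbour of \<open>v\<close> and
        \<open>y\<close>, so these are at distance 2.\<close>
      have "x0 \<in> T" using C(3) E_sym[OF v(1)] by (simp add: T_def)
      then have "E y x0" using False y C by (auto simp: gclique_def)
      then show ?thesis
        using common_nonadj(2)[of v y x0] False y v E_sym eq by (auto simp: T_def)
    qed
  qed
  \<comment> \<open>With 25 = 6 + 19 the sum is 21 * 6 + 3 * 19.\<close>
  also have "\<dots> = (\<Sum>y\<in>C. 6 + (if y \<in> T then 19 else 0))"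
    by (intro sum.cong) auto
  also have "\<dots> = 183"
    using T finC C(2) by (simp add: sum.distrib Int_absorb1 flip: sum.inter_restrict)
  finally show False by simp
qed

end

section \<open>Graph distance\<close>

lemma length_rev_path: "length (rev_path p) = length p"
  by (induction p) auto

context pair_graph begin

text \<open>The value is meaningful only when a walk exists; below, the finite diameter provides
  one.\<close>

definition walk_dist :: "'a \<Rightarrow> 'a \<Rightarrow> nat" where
  "walk_dist x y = (LEAST n. \<exists>p. awalk x p y \<and> length p = n)"

lemma walk_dist_le: "awalk x p y \<Longrightarrow> walk_dist x y \<le> length p"
  unfolding walk_dist_def by (rule Least_le) blast

lemma walk_dist_attained:
  assumes "awalk x p y"
  obtains q where "awalk x q y" "length q = walk_dist x y"
proof -
  have "\<exists>q. awalk x q y \<and> length q = walk_dist x y"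
    unfolding walk_dist_def by (rule LeastI_ex) (use assms in blast)
  then show thesis using that by blast
qed

lemma gdist_walk_dist:
  assumes "awalk x p y"
  shows "gdist G x y = ereal (real (walk_dist x y))"
proof -
  obtain q where q: "awalk x q y" "length q = walk_dist x y"
    using walk_dist_attained[OF assms] .
  show ?thesis
    unfolding gdist_eq_walk_length
  proof (rule antisym)
    show "(INF p\<in>{p. awalk x p y}. ereal (real (length p))) \<le> ereal (real (walk_dist x y))"
      by (rule INF_lower2[of q]) (use q in auto)
    show "ereal (real (walk_dist x y)) \<le> (INF p\<in>{p. awalk x p y}. ereal (real (length p)))"
      by (rule INF_greatest) (auto intro: walk_dist_le)
  qed
qed

text \<open>An infimum over no walks is \<infinity>.\<close>

lemma ex_walk:
  assumes "gdist G x y \<noteq> \<infinity>"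
  shows "\<exists>p. awalk x p y"
proof (rule ccontr)
  assume "\<not> ?thesis"
  then have "{p. awalk x p y} = {}" by blast
  then have "gdist G x y = \<infinity>"
    unfolding gdist_eq_walk_length by (simp add: top_ereal_def)
  then show False using assms by simp
qed

section \<open>Transfer from extended-real to natural-number distance\<close>

lemma not_distance_regular_80_54_12: "\<not> distance_regular G [80, 54, 12] [1, 6, 60]"
proof
  assume dr: "distance_regular G [80, 54, 12] [1, 6, 60]"
  define E where "E x y \<longleftrightarrow> (x, y) \<in> parcs G" for x y
  define b where "b i = ([80, 54, 12] @ [0::nat]) ! i" for i
  define c where "c i = (0 # [1, 6, 60::nat]) ! i" for i
  have diam: "graph_diameter G = 3" and conn: "Digraph_Component.connected (with_proj G)"
    using dr by (auto simp: distance_regular_def)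
  have cb: "card {z. E y z \<and> gdist G x z = ereal (real i - 1)} = c i"
    "card {z. E y z \<and> gdist G x z = ereal (real i + 1)} = b i"
    if "i \<le> 3" "x \<in> pverts G" "y \<in> pverts G" "gdist G x y = ereal (real i)" for i x y
    using dr that unfolding distance_regular_def E_def b_def c_def by auto
  have le3: "gdist G x y \<le> 3" if "x \<in> pverts G" "y \<in> pverts G" for x y
    unfolding diam[symmetric] graph_diameter_def
    by (rule SUP_upper2[of "(x, y)"]) (use that in auto)
  have walk: "\<exists>p. awalk x p y" if "x \<in> pverts G" "y \<in> pverts G" for x y
    by (rule ex_walk) (use le3[OF that] in auto)
  have gd: "gdist G x y = ereal (real (walk_dist x y))" if "x \<in> pverts G" "y \<in> pverts G" for x y
    using walk[OF that] gdist_walk_dist by blast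
  have d3: "walk_dist x y \<le> 3" if "x \<in> pverts G" "y \<in> pverts G" for x y
    using le3[OF that] gd[OF that] by simp
  have EV: "x \<in> pverts G \<and> y \<in> pverts G" if "E x y" for x y
    using that arc_fst_in_verts arc_snd_in_verts by (fastforce simp: E_def)
  have Esym: "E y x" if "E x y" for x y
    using that arcs_symmetric by (auto simp: E_def)
  have Ewalk: "awalk x [(x, y)] y" if "E x y" for x y
    using that EV[OF that] by (auto simp: awalk_simps E_def)
  have d0: "walk_dist x y = 0 \<longleftrightarrow> x = y" if xy: "x \<in> pverts G" "y \<in> pverts G" for x y
  proof
    assume "walk_dist x y = 0"
    then obtain q where "awalk x q y" "length q = 0"
      using walk[OF xy] walk_dist_attained by metis
    then show "x = y" by (simp add: awalk_Nil_iff)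
  next
    assume "x = y"
    then show "walk_dist x y = 0"
      using walk_dist_le[of x "[]" y] xy by (simp add: awalk_Nil_iff)
  qed
  have d1: "walk_dist x y = 1 \<longleftrightarrow> E x y" if xy: "x \<in> pverts G" "y \<in> pverts G" for x y
  proof
    assume "walk_dist x y = 1"
    then obtain q where q: "awalk x q y" "length q = Suc 0"
      using walk[OF xy] walk_dist_attained by (metis One_nat_def)
    then obtain e where "q = [e]" by (auto simp: length_Suc_conv)
    then show "E x y" using q by (auto simp: awalk_simps E_def)
  next
    assume "E x y"
    then have "walk_dist x y \<le> 1" "x \<noteq> y"
      using walk_dist_le[OF Ewalk] no_loops' by (fastforce simp: E_def)+
    then show "walk_dist x y = 1" using d0[OF xy] by linarith
  qed
  have dsym_le: "walk_dist y x \<le> walk_dist x y" if xy: "x \<in> pverts G" "y \<in> pverts G" for x y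
  proof -
    obtain q where "awalk x q y" "length q = walk_dist x y"
      using walk[OF xy] walk_dist_attained by metis
    then show ?thesis using walk_dist_le[of y "rev_path q" x] by (simp add: length_rev_path)
  qed
  have dstep: "walk_dist x z \<le> walk_dist x y + 1" if xyz: "x \<in> pverts G" "E y z" for x y z
  proof -
    obtain q where "awalk x q y" "length q = walk_dist x y"
      using walk[of x y] walk_dist_attained xyz EV by metis
    then show ?thesis
      using walk_dist_le[OF awalk_appendI[OF _ Ewalk[OF xyz(2)]]] by fastforce
  qed
  interpret drg_80_54_12 "pverts G" E walk_dist b c
  proof
    show "finite (pverts G)" by (rule pair_finite_verts)
    show "pverts G \<noteq> {}"
      using conn by (auto simp: connected_def strongly_connected_def)
    show "walk_dist x y = walk_dist y x" if "x \<in> pverts G" "y \<in> pverts G" for x y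
      using dsym_le that by (simp add: le_antisym)
    show "card {z. E y z \<and> walk_dist x z + 1 = walk_dist x y} = c (walk_dist x y)"
      if xy: "x \<in> pverts G" "y \<in> pverts G" for x y
    proof -
      \<comment> \<open>At distance 0 both sets are empty, so real and natural-number subtraction do
        not conflict.\<close>
      have "{z. E y z \<and> gdist G x z = ereal (real (walk_dist x y) - 1)} =
          {z. E y z \<and> walk_dist x z + 1 = walk_dist x y}"
        using gd[OF xy(1)] EV by (auto simp: algebra_simps)
      then show ?thesis using cb(1)[OF d3[OF xy] xy gd[OF xy]] by simp
    qed
    show "card {z. E y z \<and> walk_dist x z = walk_dist x y + 1} = b (walk_dist x y)"
      if xy: "x \<in> pverts G" "y \<in> pverts G" for x y
    proof -
      have "{z. E y z \<and> gdist G x z = ereal (real (walk_dist x y) + 1)} =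
          {z. E y z \<and> walk_dist x z = walk_dist x y + 1}"
        using gd[OF xy(1)] EV by auto
      then show ?thesis using cb(2)[OF d3[OF xy] xy gd[OF xy]] by simp
    qed
  qed (use EV Esym d3 d0 d1 dstep in \<open>auto simp: b_def c_def\<close>)
  show False by (rule contradiction)
qed

end

theorem theorem5p6:
  shows "\<not> (\<exists>G :: 'a pair_pre_digraph. distance_regular G [80, 54, 12] [1, 6, 60])"
  using pair_graph.not_distance_regular_80_54_12 unfolding distance_regular_def by blast

end
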